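(* The logics $\mathsf L(\mathfrak G_2)$ and $\mathsf L(\mathfrak G_2)\cap\mathsf L(\mathfrak C_5)$ have finitary unification, but neither of them has projective approximation.
   Context: A frame is a finite poset with a least element; $\mathsf L(\mathfrak F)$ is the set of intuitionistic formulas valid in all Kripke models over $\mathfrak F$. $\mathfrak G_2$: elements $r,a,b,c,d$ with $r<a$, $r<b$, $b<c$, $b<d$ (and transitivity), $a,c,d$ maximal, no other relations. $\mathfrak C_5$: elements $r,a,b,c,t,d$ with $r<a$, $r<b$, $a<c$, $a<t$, $b<t$, $b<d$ (and transitivity), $c,t,d$ maximal, no other relations. Unification in $\mathsf L$ is finitary if it is not unitary and every $\mathsf L$-unifiable formula has a finite complete set of unifiers (a set $\Sigma$ such that every unifier $\mu$ has some $\varepsilon\in\Sigma$ with $\alpha\circ\varepsilon=_{\mathsf L}\mu$ for some substitution $\alpha$). An $\mathsf L$-unifier $\varepsilon$ of $A$ is projective if $A\vdash_{\mathsf L}\varepsilon(x)\leftrightarrow x$ for all variables $x$; $\mathsf L$ has projective approximation if for every $A$ there is a finite set $\Pi(A)$ of formulas having projective unifiers, each $B\in\Pi(A)$ with $\mathrm{Var}(B)\subseteq\mathrm{Var}(A)$ and $B\vdash_{\mathsf L}A$, such that each $\mathsf L$-unifier of $A$ unifies some $B\in\Pi(A)$. *)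

theory Defs
  imports Main
begin

datatype fm = Falsum | Var nat | And fm fm | Or fm fm | Imp fm fm

definition Iff :: "fm \<Rightarrow> fm \<Rightarrow> fm" where
  "Iff A B = And (Imp A B) (Imp B A)"

fun vars :: "fm \<Rightarrow> nat set" where
  "vars Falsum = {}"
| "vars (Var x) = {x}"
| "vars (And A B) = vars A \<union> vars B"
| "vars (Or A B) = vars A \<union> vars B"
| "vars (Imp A B) = vars A \<union> vars B"


text \<open>A frame is given by its (reflexive) order relation; its set of elements is
  the \<^const>\<open>Field\<close> of that relation.\<close>

definition frame :: "'w rel \<Rightarrow> bool" where
  "frame R \<longleftrightarrow> finite (Field R) \<and> Partial_order R \<and> (\<exists>r\<in>Field R. \<forall>w\<in>Field R. (r, w) \<in> R)"

definition persistent :: "'w rel \<Rightarrow> ('w \<Rightarrow> nat \<Rightarrow> bool) \<Rightarrow> bool" where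
  "persistent R V \<longleftrightarrow> (\<forall>u v x. (u, v) \<in> R \<longrightarrow> V u x \<longrightarrow> V v x)"

fun forces :: "'w rel \<Rightarrow> ('w \<Rightarrow> nat \<Rightarrow> bool) \<Rightarrow> 'w \<Rightarrow> fm \<Rightarrow> bool" where
  "forces R V w Falsum \<longleftrightarrow> False"
| "forces R V w (Var x) \<longleftrightarrow> V w x"
| "forces R V w (And A B) \<longleftrightarrow> forces R V w A \<and> forces R V w B"
| "forces R V w (Or A B) \<longleftrightarrow> forces R V w A \<or> forces R V w B"
| "forces R V w (Imp A B) \<longleftrightarrow> (\<forall>v. (w, v) \<in> R \<longrightarrow> forces R V v A \<longrightarrow> forces R V v B)"

definition logic_of :: "'w rel \<Rightarrow> fm set" where
  "logic_of R = {A. \<forall>V. persistent R V \<longrightarrow> (\<forall>w\<in>Field R. forces R V w A)}"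

text \<open>Derivability from \<open>X\<close> in a logic \<open>L\<close>. The only rule is modus ponens:
  substitution is not applied to the premises in \<open>X\<close>.\<close>

inductive derives :: "fm set \<Rightarrow> fm set \<Rightarrow> fm \<Rightarrow> bool" for L X where
  logic: "A \<in> L \<Longrightarrow> derives L X A"
| prem: "A \<in> X \<Longrightarrow> derives L X A"
| mp: "derives L X (Imp A B) \<Longrightarrow> derives L X A \<Longrightarrow> derives L X B"


type_synonym substitution = "nat \<Rightarrow> fm"

fun subst :: "substitution \<Rightarrow> fm \<Rightarrow> fm" where
  "subst \<sigma> Falsum = Falsum"
| "subst \<sigma> (Var x) = \<sigma> x"
| "subst \<sigma> (And A B) = And (subst \<sigma> A) (subst \<sigma> B)"
| "subst \<sigma> (Or A B) = Or (subst \<sigma> A) (subst \<sigma> B)"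
| "subst \<sigma> (Imp A B) = Imp (subst \<sigma> A) (subst \<sigma> B)"

definition subst_comp :: "substitution \<Rightarrow> substitution \<Rightarrow> substitution" where
  "subst_comp \<alpha> \<epsilon> = (\<lambda>x. subst \<alpha> (\<epsilon> x))"

definition subst_eq :: "fm set \<Rightarrow> nat set \<Rightarrow> substitution \<Rightarrow> substitution \<Rightarrow> bool" where
  "subst_eq L X \<sigma> \<tau> \<longleftrightarrow> (\<forall>x\<in>X. Iff (\<sigma> x) (\<tau> x) \<in> L)"

definition unifier :: "fm set \<Rightarrow> fm \<Rightarrow> substitution \<Rightarrow> bool" where
  "unifier L A \<sigma> \<longleftrightarrow> subst \<sigma> A \<in> L"

definition unifiable :: "fm set \<Rightarrow> fm \<Rightarrow> bool" where
  "unifiable L A \<longleftrightarrow> (\<exists>\<sigma>. unifier L A \<sigma>)"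

text \<open>As usual in unification theory, unifiers of \<open>A\<close> are compared on the variables of
  \<open>A\<close>; their values elsewhere are irrelevant.\<close>

definition complete_set_of_unifiers :: "fm set \<Rightarrow> fm \<Rightarrow> substitution set \<Rightarrow> bool" where
  "complete_set_of_unifiers L A S \<longleftrightarrow>
     (\<forall>\<epsilon>\<in>S. unifier L A \<epsilon>) \<and>
     (\<forall>\<mu>. unifier L A \<mu> \<longrightarrow> (\<exists>\<epsilon>\<in>S. \<exists>\<alpha>. subst_eq L (vars A) (subst_comp \<alpha> \<epsilon>) \<mu>))"

definition unitary_unification :: "fm set \<Rightarrow> bool" where
  "unitary_unification L \<longleftrightarrow>
     (\<forall>A. unifiable L A \<longrightarrow> (\<exists>\<epsilon>. complete_set_of_unifiers L A {\<epsilon>}))"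

definition finitary_unification :: "fm set \<Rightarrow> bool" where
  "finitary_unification L \<longleftrightarrow>
     \<not> unitary_unification L \<and>
     (\<forall>A. unifiable L A \<longrightarrow> (\<exists>S. finite S \<and> complete_set_of_unifiers L A S))"

definition projective_unifier :: "fm set \<Rightarrow> fm \<Rightarrow> substitution \<Rightarrow> bool" where
  "projective_unifier L A \<epsilon> \<longleftrightarrow>
     unifier L A \<epsilon> \<and> (\<forall>x. derives L {A} (Iff (\<epsilon> x) (Var x)))"

definition projective_approximation :: "fm set \<Rightarrow> bool" where
  "projective_approximation L \<longleftrightarrow>
     (\<forall>A. \<exists>P. finite P \<and>
        (\<forall>B\<in>P. (\<exists>\<epsilon>. projective_unifier L B \<epsilon>) \<and> vars B \<subseteq> vars A \<and> derives L {B} A) \<and>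
        (\<forall>\<sigma>. unifier L A \<sigma> \<longrightarrow> (\<exists>B\<in>P. unifier L B \<sigma>)))"


datatype g2_world = G_r | G_a | G_b | G_c | G_d

definition G2 :: "g2_world rel" where
  "G2 = {(G_r, G_a), (G_r, G_b), (G_b, G_c), (G_b, G_d)}\<^sup>*"

datatype c5_world = C_r | C_a | C_b | C_c | C_t | C_d

definition C5 :: "c5_world rel" where
  "C5 = {(C_r, C_a), (C_r, C_b), (C_a, C_c), (C_a, C_t), (C_b, C_t), (C_b, C_d)}\<^sup>*"

lemma G2_eq: "G2 = Id \<union> {(G_r, G_a), (G_r, G_b), (G_b, G_c), (G_b, G_d), (G_r, G_c), (G_r, G_d)}"
  (is "_ = ?R")
proof
  have "(x, y) \<in> G2 \<Longrightarrow> (x, y) \<in> ?R" for x y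
    unfolding G2_def by (induction rule: rtrancl_induct) auto
  then show "G2 \<subseteq> ?R" by auto
  show "?R \<subseteq> G2"
    unfolding G2_def by (auto intro: rtrancl_into_rtrancl)
qed

lemma C5_eq: "C5 = Id \<union> {(C_r, C_a), (C_r, C_b), (C_a, C_c), (C_a, C_t), (C_b, C_t), (C_b, C_d),
    (C_r, C_c), (C_r, C_t), (C_r, C_d)}"
  (is "_ = ?R")
proof
  have "(x, y) \<in> C5 \<Longrightarrow> (x, y) \<in> ?R" for x y
    unfolding C5_def by (induction rule: rtrancl_induct) auto
  then show "C5 \<subseteq> ?R" by auto
  show "?R \<subseteq> C5"
    unfolding C5_def by (auto intro: rtrancl_into_rtrancl)
qed

lemma Field_G2: "Field G2 = UNIV"
  by (auto simp: G2_eq Field_def)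

lemma Field_C5: "Field C5 = UNIV"
  by (auto simp: C5_eq Field_def)

lemma frame_G2: "frame G2"
proof -
  have "(UNIV :: g2_world set) = {G_r, G_a, G_b, G_c, G_d}"
    using g2_world.exhaust by auto
  then have "finite (UNIV :: g2_world set)"
    by (metis finite.emptyI finite.insertI)
  moreover have "(G_r, w) \<in> G2" for w
    by (cases w) (auto simp: G2_eq)
  moreover have "antisym G2"
    by (auto simp: G2_eq antisym_def)
  moreover have "refl G2" "trans G2"
    by (auto simp: G2_def refl_rtrancl trans_rtrancl)
  ultimately show ?thesis
    by (auto simp: frame_def Field_G2 partial_order_on_def preorder_on_def)
qed

lemma frame_C5: "frame C5"
proof -
  have "(UNIV :: c5_world set) = {C_r, C_a, C_b, C_c, C_t, C_d}"
    using c5_world.exhaust by auto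
  then have "finite (UNIV :: c5_world set)"
    by (metis finite.emptyI finite.insertI)
  moreover have "(C_r, w) \<in> C5" for w
    by (cases w) (auto simp: C5_eq)
  moreover have "antisym C5"
    by (auto simp: C5_eq antisym_def)
  moreover have "refl C5" "trans C5"
    by (auto simp: C5_def refl_rtrancl trans_rtrancl)
  ultimately show ?thesis
    by (auto simp: frame_def Field_C5 partial_order_on_def preorder_on_def)
qed

end

theory Submission imports Defs begin

text \<open>Let \<open>T Y\<close> be the finite poset of theories, in the variables \<open>Y\<close>, of points of models on the
  frame, where the sum of \<open>G2\<close> and \<open>C5\<close> serves as frame for the intersection of the two logics.
  A unifier \<open>\<mu>\<close> of \<open>A\<close> with values in the variables \<open>Y\<close> is a p-morphism from \<open>T Y\<close> into the points
  of \<open>T X\<close> containing \<open>A\<close>, where \<open>X\<close> are the variables of \<open>A\<close>. Add to \<open>X\<close> one variable for each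
  subset of \<open>T X\<close>, and use them to colour each maximal point of \<open>T Y\<close> by the set of values of \<open>\<mu>\<close>
  at the forks below it. This gives a p-morphism from \<open>T Y\<close> to \<open>T Z\<close>, where \<open>Z\<close> does not depend
  on \<open>\<mu>\<close>, and by gluing forks \<open>\<mu>\<close> factors through a p-morphism on \<open>T Z\<close>; there are finitely many
  of these. Unification is not unitary because of \<open>x \<or> \<not> x\<close>.

  Projective approximation fails since the points forcing a formula with a projective unifier are
  closed under adding a root, and \<open>bad_formula\<close> below has a unifier whose values leave it under this
  closure.\<close>

section \<open>Extending p-morphisms\<close>

text \<open>A poset is given by its carrier and the map \<open>up\<close> sending each element to its
  principal upset.\<close>

definition poset :: "'a set \<Rightarrow> ('a \<Rightarrow> 'a set) \<Rightarrow> bool" where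
  "poset P up \<longleftrightarrow> (\<forall>p\<in>P. p \<in> up p \<and> up p \<subseteq> P \<and>
     (\<forall>q\<in>up p. up q \<subseteq> up p \<and> (p \<in> up q \<longrightarrow> p = q)))"

text \<open>The single equation holds both conditions: one inclusion is monotonicity of
  \<open>k\<close>, the other is the back condition.\<close>

definition p_morphism :: "('a \<Rightarrow> 'b) \<Rightarrow> 'a set \<Rightarrow> ('a \<Rightarrow> 'a set) \<Rightarrow> 'b set \<Rightarrow> ('b \<Rightarrow> 'b set) \<Rightarrow> bool" where
  "p_morphism k P up Q up' \<longleftrightarrow> (\<forall>p\<in>P. k p \<in> Q \<and> up' (k p) = k ` up p)"

definition is_max :: "('a \<Rightarrow> 'a set) \<Rightarrow> 'a \<Rightarrow> bool" where
  "is_max up m \<longleftrightarrow> up m = {m}"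

text \<open>\<open>b\<close>, \<open>m\<close> and \<open>n\<close> may coincide, so maximal
  elements and chains of two count as well. This makes the notion stable under p-morphisms, which
  may identify points.\<close>

definition forkish :: "'a set \<Rightarrow> ('a \<Rightarrow> 'a set) \<Rightarrow> 'a \<Rightarrow> bool" where
  "forkish P up b \<longleftrightarrow> b \<in> P \<and>
     (\<exists>m\<in>P. \<exists>n\<in>P. is_max up m \<and> is_max up n \<and> up b = {b, m, n})"

text \<open>The pairs that may be the covers of a point of depth 3: as in \<open>G2\<close>, or, if \<open>D\<close> holds,
  as in \<open>C5\<close>.\<close>

definition joinable :: "bool \<Rightarrow> 'a set \<Rightarrow> ('a \<Rightarrow> 'a set) \<Rightarrow> 'a \<Rightarrow> 'a \<Rightarrow> bool" where
  "joinable D P up a b \<longleftrightarrow> forkish P up a \<and> forkish P up b \<and>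
     (is_max up a \<or> D \<and> (\<exists>t. is_max up t \<and> t \<in> up a \<and> t \<in> up b))"

definition structured :: "bool \<Rightarrow> 'a set \<Rightarrow> ('a \<Rightarrow> 'a set) \<Rightarrow> bool" where
  "structured D P up \<longleftrightarrow> (\<forall>q\<in>P. forkish P up q \<or>
     (\<exists>a b. joinable D P up a b \<and> up q = {q} \<union> up a \<union> up b))"

text \<open>A converse of \<open>structured\<close>: every admissible configuration has a point
  right below it.\<close>

definition amalgamating :: "bool \<Rightarrow> 'a set \<Rightarrow> ('a \<Rightarrow> 'a set) \<Rightarrow> bool" where
  "amalgamating D P up \<longleftrightarrow>
     (\<forall>m\<in>P. \<forall>n\<in>P. is_max up m \<longrightarrow> is_max up n \<longrightarrow> (\<exists>p\<in>P. up p = {p, m, n})) \<and>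
     (\<forall>a b. joinable D P up a b \<longrightarrow> (\<exists>p\<in>P. up p = {p} \<union> up a \<union> up b))"

section \<open>Forkish elements, extremal elements and images under p-morphisms\<close>

lemma forkish_up:
  assumes "forkish P up b" "x \<in> up b"
  shows "x = b \<or> is_max up x"
  using assms by (auto simp: forkish_def)

lemma max_forkish: "p \<in> P \<Longrightarrow> is_max up p \<Longrightarrow> forkish P up p"
  by (auto simp: forkish_def is_max_def)

lemma forkish_in_up:
  assumes "poset P up" "forkish P up b" "x \<in> up b"
  shows "forkish P up x"
  using assms forkish_up[OF assms(2,3)]
  by (metis forkish_def max_forkish poset_def subsetD)

text \<open>Otherwise the elements \<open>a\<close> and \<open>b\<close> given by
  \<open>structured\<close> differ from \<open>p\<close>, hence are maximal, and
  \<open>up p = {p, a, b}\<close> makes \<open>p\<close> forkish after all.\<close>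

lemma forkish_if_covers_max:
  assumes st: "structured D P up" and po: "poset P up" and p: "p \<in> P"
    and mx: "\<And>x. x \<in> up p \<Longrightarrow> x \<noteq> p \<Longrightarrow> is_max up x"
  shows "forkish P up p"
proof (rule ccontr)
  assume nf: "\<not> forkish P up p"
  then obtain a b where ab: "joinable D P up a b" "up p = {p} \<union> up a \<union> up b"
    using st p by (auto simp: structured_def)
  have f: "forkish P up a" "forkish P up b" using ab by (auto simp: joinable_def)
  then have "a \<in> P" "b \<in> P" by (auto simp: forkish_def)
  then have "a \<in> up p" "b \<in> up p" using ab(2) po by (auto simp: poset_def)
  moreover have "a \<noteq> p" "b \<noteq> p" using f nf by auto
  ultimately have "is_max up a" "is_max up b" using mx by auto
  then show False using nf p \<open>a \<in> P\<close> \<open>b \<in> P\<close> ab(2)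
    unfolding forkish_def is_max_def by (metis insert_is_Un Un_commute Un_insert_left)
qed

text \<open>Moving to a different element of the upset that satisfies \<open>C\<close> strictly
  shrinks the upset, by antisymmetry, so this stops.\<close>

lemma ex_extremal_in_up:
  assumes po: "poset P up" and fin: "finite P" and p: "p \<in> P" and "C p"
  shows "\<exists>q\<in>up p. C q \<and> (\<forall>x\<in>up q. C x \<longrightarrow> x = q)"
  using p \<open>C p\<close>
proof (induction "card (up p)" arbitrary: p rule: less_induct)
  case less
  show ?case
  proof (cases "\<forall>x\<in>up p. C x \<longrightarrow> x = p")
    case True
    then show ?thesis using less.prems po by (auto simp: poset_def)
  next
    case False
    then obtain x where x: "x \<in> up p" "C x" "x \<noteq> p" by blast
    have xP: "x \<in> P" using po less.prems x by (auto simp: poset_def)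
    have sub: "up x \<subseteq> up p" "p \<notin> up x" "p \<in> up p" using po less.prems x by (auto simp: poset_def)
    have "finite (up p)" using fin po less.prems by (meson finite_subset poset_def)
    then have "card (up x) < card (up p)" using sub by (metis psubset_card_mono psubsetI)
    from less.hyps[OF this xP x(2)] show ?thesis using sub by blast
  qed
qed

lemma ex_max_above:
  assumes po: "poset P up" and fin: "finite P" and p: "p \<in> P"
  shows "\<exists>q\<in>up p. is_max up q"
proof -
  obtain q where q: "q \<in> up p" "\<forall>x\<in>up q. x = q"
    using ex_extremal_in_up[OF po fin p, of "\<lambda>_. True"] by auto
  then have "q \<in> up q" using po p by (metis poset_def subsetD)
  then show ?thesis using q by (auto simp: is_max_def)
qed

lemma p_morphism_max:
  assumes "p_morphism k P up Q up'" "p \<in> P" "is_max up p"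
  shows "is_max up' (k p)"
  using assms by (auto simp: p_morphism_def is_max_def)

lemma p_morphism_forkish:
  assumes k: "p_morphism k P up Q up'" and b: "forkish P up b"
  shows "forkish Q up' (k b)"
proof -
  obtain m n where "b \<in> P" "m \<in> P" "n \<in> P" "is_max up m" "is_max up n" "up b = {b, m, n}"
    using b by (auto simp: forkish_def)
  moreover from this have "up' (k b) = {k b, k m, k n}" using k by (auto simp: p_morphism_def)
  ultimately show ?thesis
    using k p_morphism_max[OF k] unfolding forkish_def p_morphism_def by blast
qed

lemma p_morphism_joinable:
  assumes k: "p_morphism k P up Q up'" and po: "poset P up" and ab: "joinable D P up a b"
  shows "joinable D Q up' (k a) (k b)"
proof -
  have P: "a \<in> P" "b \<in> P" using ab by (auto simp: joinable_def forkish_def)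
  have "is_max up' (k a) \<or> D \<and> (\<exists>t. is_max up' t \<and> t \<in> up' (k a) \<and> t \<in> up' (k b))"
    using ab unfolding joinable_def
  proof (elim conjE disjE exE)
    assume "is_max up a" then show ?thesis using p_morphism_max[OF k P(1)] by simp
  next
    fix t assume t: D "is_max up t" "t \<in> up a" "t \<in> up b"
    then have "t \<in> P" using po P by (auto simp: poset_def)
    then show ?thesis using t p_morphism_max[OF k] k P unfolding p_morphism_def by blast
  qed
  then show ?thesis using ab p_morphism_forkish[OF k] by (auto simp: joinable_def)
qed

text \<open>The set \<open>E m\<close> of \<open>h\<close>-values of forkish elements below \<open>m\<close> records which
  second fork can be glued at \<open>m\<close>: two forks of \<open>Q\<close> with a common maximal element may have
  preimages in \<open>P\<close> without one, and one of them is then exchanged for another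
  fork with the same \<open>h\<close>-value.\<close>

lemma extension:
  fixes D :: bool and k :: "'a \<Rightarrow> 'b" and h :: "'a \<Rightarrow> 'c"
    and upP :: "'a \<Rightarrow> 'a set" and P :: "'a set"
  defines "E \<equiv> \<lambda>m. h ` {b. forkish P upP b \<and> m \<in> upP b}"
  assumes P: "poset P upP" "finite P" "P \<noteq> {}" "structured D P upP" "amalgamating D P upP"
    and Q: "poset Q upQ" "structured D Q upQ"
    and k: "p_morphism k P upP Q upQ" and h: "p_morphism h P upP S upS"
    and refl: "\<And>p. p \<in> P \<Longrightarrow> is_max upQ (k p) \<Longrightarrow> is_max upP p"
    and kh: "\<And>p p'. p \<in> P \<Longrightarrow> p' \<in> P \<Longrightarrow> k p = k p' \<Longrightarrow> h p = h p'"
    and kE: "\<And>p p'. p \<in> P \<Longrightarrow> p' \<in> P \<Longrightarrow> is_max upP p \<Longrightarrow> is_max upP p' \<Longrightarrow> k p = k p' \<Longrightarrow> E p = E p'"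
  shows "\<exists>f. p_morphism f Q upQ S upS \<and> (\<forall>p\<in>P. f (k p) = h p) \<and> f ` Q \<subseteq> h ` P"
proof -
  have ups: "upS (h p) = h ` upP p" and hS: "h p \<in> S" if "p \<in> P" for p
    using h that by (auto simp: p_morphism_def)
  have upk: "upQ (k p) = k ` upP p" and kQ: "k p \<in> Q" if "p \<in> P" for p
    using k that by (auto simp: p_morphism_def)
  have upP: "upP p \<subseteq> P" "p \<in> upP p" if "p \<in> P" for p
    using P(1) that by (auto simp: poset_def)
  have upQ: "upQ q \<subseteq> Q" "q \<in> upQ q" if "q \<in> Q" for q
    using Q(1) that by (auto simp: poset_def)
  \<comment> \<open>A maximal \<open>q\<close> is lifted to a preimage if it has one, and to an
    arbitrary maximal point of \<open>P\<close> otherwise.\<close>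
  define lift where "lift q p \<longleftrightarrow> p \<in> P \<and> is_max upP p \<and> (\<forall>p'\<in>P. k p' = q \<longrightarrow> k p = q)" for q p
  have "\<exists>p. lift q p" if "is_max upQ q" for q
  proof (cases "\<exists>p'\<in>P. k p' = q")
    case True
    then show ?thesis using refl that by (auto simp: lift_def)
  next
    case False
    obtain p where "p \<in> P" using P(3) by blast
    then show ?thesis using False ex_max_above[OF P(1,2)] upP unfolding lift_def by blast
  qed
  then obtain l where l: "\<And>q. is_max upQ q \<Longrightarrow> lift q (l q)" by metis
  have lP: "l q \<in> P" "is_max upP (l q)" if "is_max upQ q" for q
    using l[OF that] by (auto simp: lift_def)
  have lk: "h (l (k p)) = h p" "E (l (k p)) = E p" if "p \<in> P" "is_max upQ (k p)" for p
    using l[OF that(2)] that refl[OF that] kh[of "l (k p)" p] kE[of "l (k p)" p] by (auto simp: lift_def)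
  define M where "M q = {m \<in> upQ q. is_max upQ m}" for q
  \<comment> \<open>The admissible values at a forkish \<open>q\<close>. Membership in every
    \<open>E (l m)\<close> is what later allows two forks to be glued.\<close>
  define ok where "ok q s \<longleftrightarrow> (\<forall>p\<in>P. k p = q \<longrightarrow> s = h p) \<and> s \<in> h ` P
      \<and> upS s = {s} \<union> (\<lambda>m. h (l m)) ` M q \<and> (\<forall>m\<in>M q. s \<in> E (l m))
      \<and> (is_max upQ q \<longrightarrow> s = h (l q))" for q s
  have "\<exists>s. ok q s" if q: "forkish Q upQ q" for q
  proof (cases "\<exists>p\<in>P. k p = q")
    case True
    then obtain p0 where p0: "p0 \<in> P" "k p0 = q" by blast
    \<comment> \<open>Taking \<open>p\<close> last among the preimages of \<open>q\<close> above
      \<open>p0\<close> sends everything strictly above \<open>p\<close> to maximal points. By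
      \<open>refl\<close> these elements are maximal themselves, so \<open>p\<close> is
      forkish.\<close>
    obtain p where p: "p \<in> upP p0" "k p = q" "\<forall>x\<in>upP p. k x = q \<longrightarrow> x = p"
      using ex_extremal_in_up[OF P(1,2) p0(1), of "\<lambda>p. k p = q"] p0(2) by auto
    have pP: "p \<in> P" using p upP p0 by blast
    have above: "is_max upP x" if "x \<in> upP p" "x \<noteq> p" for x
    proof -
      have "k x \<in> upQ q" "k x \<noteq> q" using p that upk[OF pP] by auto
      then show ?thesis using refl forkish_up[OF q] upP pP that by blast
    qed
    have pf: "forkish P upP p"
      by (rule forkish_if_covers_max[OF P(4,1) pP above])
    have "ok q (h p)"
      unfolding ok_def
    proof (intro conjI ballI impI)
      show "h p = h p'" if "p' \<in> P" "k p' = q" for p' using kh[of p p'] that pP p by auto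
      show "h p \<in> h ` P" using pP by simp
      have *: "x = p \<or> k x \<in> M q \<and> h x = h (l (k x))" if "x \<in> upP p" for x
      proof (cases "x = p")
        case False
        then have "k x \<in> M q" unfolding M_def
          using p that upk[OF pP] p_morphism_max[OF k _ above] upP(1)[OF pP] by auto
        then show ?thesis using lk(1)[of x] that upP(1)[OF pP] by (auto simp: M_def)
      qed simp
      have **: "\<exists>x\<in>upP p. k x = m \<and> h x = h (l m) \<and> E x = E (l m)" if "m \<in> M q" for m
      proof -
        have "m \<in> k ` upP p" using that upk[OF pP] p(2) by (simp add: M_def)
        then obtain x where x: "x \<in> upP p" "k x = m" by blast
        then have "x \<in> P" "is_max upQ (k x)" using upP(1)[OF pP] that by (auto simp: M_def)
        from lk[OF this] show ?thesis using x by auto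
      qed
      show "upS (h p) = {h p} \<union> (\<lambda>m. h (l m)) ` M q"
      proof
        show "upS (h p) \<subseteq> {h p} \<union> (\<lambda>m. h (l m)) ` M q"
          using * by (force simp: ups[OF pP])
        show "{h p} \<union> (\<lambda>m. h (l m)) ` M q \<subseteq> upS (h p)"
        proof
          fix y assume "y \<in> {h p} \<union> (\<lambda>m. h (l m)) ` M q"
          then consider "y = h p" | m where "m \<in> M q" "y = h (l m)" by auto
          then have "\<exists>x\<in>upP p. h x = y"
          proof cases
            case 1 then show ?thesis using upP(2)[OF pP] by auto
          next
            case (2 m) then show ?thesis using **[of m] by auto
          qed
          then show "y \<in> upS (h p)" by (auto simp: ups[OF pP])
        qed
      qed
      show "h p \<in> E (l m)" if m: "m \<in> M q" for m
        using **[OF m] pf unfolding E_def by blast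
      show "h p = h (l q)" if "is_max upQ q" using lk(1)[OF pP] that p by simp
    qed
    then show ?thesis ..
  next
    case False
    obtain m n where mn: "m \<in> Q" "n \<in> Q" "is_max upQ m" "is_max upQ n" "upQ q = {q, m, n}"
      using q by (auto simp: forkish_def)
    have Mq: "M q = {m, n}" using mn unfolding M_def is_max_def by auto
    \<comment> \<open>Outside the image of \<open>k\<close>, the fork is rebuilt in \<open>P\<close>
      over the lifts of its two maximal points.\<close>
    obtain p where p: "p \<in> P" "upP p = {p, l m, l n}"
      using P(5) lP[OF mn(3)] lP[OF mn(4)] unfolding amalgamating_def by blast
    have pf: "forkish P upP p"
      using p lP[OF mn(3)] lP[OF mn(4)] unfolding forkish_def by blast
    show ?thesis
    proof (cases "is_max upQ q")
      case True
      then have "m = q" "n = q" using mn(5) by (auto simp: is_max_def)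
      have "ok q (h (l q))"
        unfolding ok_def using False lP[OF True] max_forkish[OF lP[OF True]] ups[OF lP(1)[OF True]] Mq
        by (auto simp: \<open>m = q\<close> \<open>n = q\<close> E_def is_max_def)
      then show ?thesis ..
    next
      case nm: False
      have "ok q (h p)"
        unfolding ok_def using False p pf nm Mq ups[OF p(1)] by (auto simp: E_def)
      then show ?thesis ..
    qed
  qed
  then obtain f1 where f1: "\<And>q. forkish Q upQ q \<Longrightarrow> ok q (f1 q)" by metis
  have f1k: "f1 (k p) = h p" if "p \<in> P" "forkish Q upQ (k p)" for p
    using f1[OF that(2)] that by (auto simp: ok_def)
  have f1M: "f1 m = h (l m)" if "m \<in> Q" "is_max upQ m" for m
    using f1[OF max_forkish[OF that]] that by (auto simp: ok_def)
  have f1up: "upS (f1 q) = f1 ` upQ q" if q: "forkish Q upQ q" for q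
  proof -
    have qQ: "q \<in> Q" using q by (simp add: forkish_def)
    have "upQ q = {q} \<union> M q" using forkish_up[OF q] upQ[OF qQ] by (auto simp: M_def)
    moreover have "f1 m = h (l m)" if "m \<in> M q" for m
      using f1M that upQ[OF qQ] by (auto simp: M_def)
    ultimately show ?thesis using f1[OF q] by (simp add: ok_def)
  qed
  \<comment> \<open>The admissible values at the remaining \<open>q\<close>: they must fit
    \<open>f1\<close>, which is already fixed on everything strictly above \<open>q\<close>.\<close>
  define good where "good q s \<longleftrightarrow> (\<forall>p\<in>P. k p = q \<longrightarrow> s = h p) \<and> s \<in> h ` P
      \<and> upS s = {s} \<union> f1 ` (upQ q - {q})" for q s
  have strict: "forkish Q upQ x" if "q \<in> Q" "\<not> forkish Q upQ q" "x \<in> upQ q" "x \<noteq> q" for q x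
    using Q(2) that forkish_in_up[OF Q(1)] unfolding structured_def joinable_def by blast
  have "\<exists>s. good q s" if q: "q \<in> Q" "\<not> forkish Q upQ q" for q
  proof (cases "\<exists>p\<in>P. k p = q")
    case True
    then obtain p where p: "p \<in> P" "k p = q" by blast
    have *: "h x = f1 (k x)" if "x \<in> upP p" "k x \<noteq> q" for x
      using f1k[of x] strict[OF q] that upk[OF p(1)] p upP[OF p(1)] by auto
    have "upS (h p) = {h p} \<union> f1 ` (upQ q - {q})"
    proof
      show "upS (h p) \<subseteq> {h p} \<union> f1 ` (upQ q - {q})"
      proof
        fix y assume "y \<in> upS (h p)"
        then obtain x where x: "x \<in> upP p" "y = h x" using ups[OF p(1)] by auto
        show "y \<in> {h p} \<union> f1 ` (upQ q - {q})"
        proof (cases "k x = q")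
          case True
          then show ?thesis using x kh[of x p] p upP[OF p(1)] by auto
        next
          case False
          then show ?thesis using * x upk[OF p(1)] p(2) by auto
        qed
      qed
      show "{h p} \<union> f1 ` (upQ q - {q}) \<subseteq> upS (h p)"
      proof
        fix y assume "y \<in> {h p} \<union> f1 ` (upQ q - {q})"
        then consider "y = h p" | z where "z \<in> upQ q" "z \<noteq> q" "y = f1 z" by auto
        then show "y \<in> upS (h p)"
        proof cases
          case 1 then show ?thesis using ups upP p by auto
        next
          case 2
          then obtain x where "x \<in> upP p" "z = k x" using upk[OF p(1)] p(2) by auto
          then have "x \<in> upP p" "y = h x" using 2 *[of x] by auto
          then show ?thesis using ups[OF p(1)] by simp
        qed
      qed
    qed
    moreover have "h p = h p'" if "p' \<in> P" "k p' = q" for p'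
      using kh[of p p'] that p by simp
    ultimately have "good q (h p)" using p(1) unfolding good_def by blast
    then show ?thesis ..
  next
    case False
    obtain a b where ab: "joinable D Q upQ a b" "upQ q = {q} \<union> upQ a \<union> upQ b"
      using Q(2) q by (auto simp: structured_def)
    then have fa: "forkish Q upQ a" and fb: "forkish Q upQ b" by (auto simp: joinable_def)
    then have aQ: "a \<in> Q" "b \<in> Q" by (auto simp: forkish_def)
    have "\<exists>pa pb. joinable D P upP pa pb \<and> h pa = f1 a \<and> h pb = f1 b"
    proof (cases "is_max upQ a")
      case True
      obtain m where "m \<in> M b"
        using forkish_def[of Q upQ b] fb by (auto simp: M_def)
      then obtain pb where "forkish P upP pb" "h pb = f1 b"
        using f1[OF fb] by (auto simp: ok_def E_def)
      then show ?thesis using f1M[OF aQ(1) True] lP[OF True] max_forkish[OF lP[OF True]]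
        by (metis joinable_def)
    next
      case nm: False
      then obtain t where t: D "is_max upQ t" "t \<in> M a" "t \<in> M b"
        using ab(1) by (auto simp: joinable_def M_def)
      \<comment> \<open>Both values lie in \<open>E (l t)\<close>, so they are attained at forkish
        elements below the same maximal point \<open>l t\<close>; these are joinable.\<close>
      obtain pa pb where "forkish P upP pa" "l t \<in> upP pa" "h pa = f1 a"
        "forkish P upP pb" "l t \<in> upP pb" "h pb = f1 b"
        using f1[OF fa] f1[OF fb] t unfolding ok_def E_def by fastforce
      then show ?thesis using t lP[OF t(2)] by (metis joinable_def)
    qed
    then obtain pa pb where pab: "joinable D P upP pa pb" "h pa = f1 a" "h pb = f1 b" by blast
    then have pabP: "pa \<in> P" "pb \<in> P" by (auto simp: joinable_def forkish_def)
    obtain p where p: "p \<in> P" "upP p = {p} \<union> upP pa \<union> upP pb"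
      using P(5) pab(1) unfolding amalgamating_def by blast
    have "upS (h p) = {h p} \<union> upS (f1 a) \<union> upS (f1 b)"
      using ups p pab pabP by (metis image_Un image_empty image_insert)
    also have "\<dots> = {h p} \<union> f1 ` (upQ a \<union> upQ b)" using f1up fa fb by auto
    also have "upQ a \<union> upQ b = upQ q - {q}"
      using ab(2) forkish_in_up[OF Q(1) fa] forkish_in_up[OF Q(1) fb] q by auto
    finally have "good q (h p)" using False p by (auto simp: good_def)
    then show ?thesis ..
  qed
  then obtain f2 where f2: "\<And>q. q \<in> Q \<Longrightarrow> \<not> forkish Q upQ q \<Longrightarrow> good q (f2 q)" by metis
  define f where "f q = (if forkish Q upQ q then f1 q else f2 q)" for q
  have fk: "f (k p) = h p" if "p \<in> P" for p
    using f1k[OF that] f2[OF kQ[OF that]] that by (auto simp: f_def good_def)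
  have fh: "f q \<in> h ` P" if "q \<in> Q" for q
    using f1[of q] f2[OF that] by (auto simp: f_def good_def ok_def)
  have fup: "upS (f q) = f ` upQ q" if q: "q \<in> Q" for q
  proof (cases "forkish Q upQ q")
    case True
    then show ?thesis using f1up[OF True] forkish_in_up[OF Q(1) True] by (auto simp: f_def)
  next
    case False
    have "f ` (upQ q - {q}) = f1 ` (upQ q - {q})"
      using strict[OF q False] by (auto simp: f_def intro!: image_cong)
    then have "upS (f q) = {f q} \<union> f ` (upQ q - {q})"
      using f2[OF q False] False by (simp add: good_def f_def)
    then show ?thesis using upQ(2)[OF q] by auto
  qed
  have "p_morphism f Q upQ S upS" using fh hS fup by (fastforce simp: p_morphism_def)
  then show ?thesis using fk fh by blast
qed

section \<open>Theories of points\<close>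

locale kripke =
  fixes R :: "'w rel"
  assumes finite_Field: "finite (Field R)"
    and partial_order: "Partial_order R"
    and nonempty: "Field R \<noteq> {}"
begin

definition upR :: "'w \<Rightarrow> 'w set" where
  "upR w = R `` {w}"

definition th :: "nat set \<Rightarrow> ('w \<Rightarrow> nat \<Rightarrow> bool) \<Rightarrow> 'w \<Rightarrow> fm set" where
  "th Y V w = {B. vars B \<subseteq> Y \<and> forces R V w B}"

text \<open>As \<open>R\<close> is finite, \<open>T Y\<close> is the dual poset of the free algebra of \<open>logic_of R\<close>
  over \<open>Y\<close>: for finite \<open>Y\<close> its upsets are definable by formulas, and substitutions
  correspond to p-morphisms.\<close>

definition T :: "nat set \<Rightarrow> fm set set" where
  "T Y = {th Y V w | V w. persistent R V \<and> w \<in> Field R}"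

definition upT :: "nat set \<Rightarrow> fm set \<Rightarrow> fm set set" where
  "upT Y t = {s \<in> T Y. t \<subseteq> s}"

section \<open>Persistence, finiteness of \<open>T Y\<close> and membership in theories\<close>

lemma refl_R: "w \<in> Field R \<Longrightarrow> (w, w) \<in> R"
  using partial_order by (simp add: partial_order_on_def preorder_on_def refl_on_def)

lemma trans_R: "(u, v) \<in> R \<Longrightarrow> (v, w) \<in> R \<Longrightarrow> (u, w) \<in> R"
  using partial_order unfolding partial_order_on_def preorder_on_def by (blast dest: transD)

lemma antisym_R: "(u, v) \<in> R \<Longrightarrow> (v, u) \<in> R \<Longrightarrow> u = v"
  using partial_order unfolding partial_order_on_def by (blast dest: antisymD)

lemma poset_R: "poset (Field R) upR"
  unfolding poset_def upR_def using refl_R trans_R antisym_R FieldI2 by fast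

lemma forces_mono:
  assumes V: "persistent R V"
  shows "forces R V u A \<Longrightarrow> (u, v) \<in> R \<Longrightarrow> forces R V v A"
proof (induction A arbitrary: u v)
  case (Var x)
  then show ?case using V by (auto simp: persistent_def)
qed (auto intro: trans_R)

lemma forces_cong:
  assumes "\<And>v x. v \<in> Field R \<Longrightarrow> x \<in> Y \<Longrightarrow> V v x = V' v x"
  shows "vars A \<subseteq> Y \<Longrightarrow> w \<in> Field R \<Longrightarrow> forces R V w A = forces R V' w A"
proof (induction A arbitrary: w)
  case (Imp A B)
  then show ?case by simp (meson FieldI2)
qed (use assms in auto)

lemma th_in_T: "persistent R V \<Longrightarrow> w \<in> Field R \<Longrightarrow> th Y V w \<in> T Y"
  by (auto simp: T_def)

lemma T_cases:
  assumes "t \<in> T Y"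
  obtains V w where "persistent R V" "w \<in> Field R" "t = th Y V w"
  using assms by (auto simp: T_def)

text \<open>By \<open>forces_cong\<close>, a theory over \<open>Y\<close> is determined by the point
  and the valuation restricted to \<open>Field R\<close> and \<open>Y\<close>; this leaves finitely
  many.\<close>

lemma finite_T:
  assumes "finite Y"
  shows "finite (T Y)"
proof (rule finite_subset)
  show "T Y \<subseteq> (\<lambda>(W, w). th Y (\<lambda>w x. (w, x) \<in> W) w) ` (Pow (Field R \<times> Y) \<times> Field R)"
  proof
    fix t assume "t \<in> T Y"
    then obtain V w where V: "w \<in> Field R" "t = th Y V w" by (auto simp: T_def)
    let ?W = "{(w, x). w \<in> Field R \<and> x \<in> Y \<and> V w x}"
    have "forces R V w B = forces R (\<lambda>w x. (w, x) \<in> ?W) w B" if "vars B \<subseteq> Y" for B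
      by (rule forces_cong[OF _ that V(1)]) simp
    then have "t = th Y (\<lambda>w x. (w, x) \<in> ?W) w" unfolding V(2) th_def by blast
    moreover have "(?W, w) \<in> Pow (Field R \<times> Y) \<times> Field R" using V by auto
    ultimately show "t \<in> (\<lambda>(W, w). th Y (\<lambda>w x. (w, x) \<in> W) w) ` (Pow (Field R \<times> Y) \<times> Field R)"
      using image_eqI[of t "\<lambda>(W, w). th Y (\<lambda>w x. (w, x) \<in> W) w" "(?W, w)"] by simp
  qed
  show "finite ((\<lambda>(W, w). th Y (\<lambda>w x. (w, x) \<in> W) w) ` (Pow (Field R \<times> Y) \<times> Field R))"
    using assms finite_Field by simp
qed

lemma T_nonempty: "T Y \<noteq> {}"
proof -
  have "persistent R (\<lambda>_ _. False)" by (simp add: persistent_def)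
  then show ?thesis using nonempty th_in_T by blast
qed

lemma poset_T: "poset (T Y) (upT Y)"
  by (auto simp: poset_def upT_def)

lemma vars_in_T: "t \<in> T Y \<Longrightarrow> B \<in> t \<Longrightarrow> vars B \<subseteq> Y"
  by (auto simp: T_def th_def)

lemma in_T_simps:
  assumes "t \<in> T Y"
  shows "Falsum \<notin> t"
    and "And A B \<in> t \<longleftrightarrow> A \<in> t \<and> B \<in> t"
    and "vars A \<subseteq> Y \<Longrightarrow> vars B \<subseteq> Y \<Longrightarrow> Or A B \<in> t \<longleftrightarrow> A \<in> t \<or> B \<in> t"
  using assms by (auto simp: T_def th_def)

lemma in_logic_iff:
  assumes "vars A \<subseteq> Y"
  shows "A \<in> logic_of R \<longleftrightarrow> (\<forall>t\<in>T Y. A \<in> t)"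
  using assms by (auto simp: logic_of_def T_def th_def)

section \<open>Definability of the upsets of \<open>T Y\<close>\<close>

lemma ex_conj:
  assumes "finite F" "\<forall>B\<in>F. vars B \<subseteq> Y"
  shows "\<exists>C. vars C \<subseteq> Y \<and> (\<forall>t\<in>T Y. C \<in> t \<longleftrightarrow> F \<subseteq> t)"
  using assms
proof (induction F)
  case empty
  show ?case by (rule exI[of _ "Imp Falsum Falsum"]) (auto simp: T_def th_def)
next
  case (insert B F)
  then obtain C where "vars C \<subseteq> Y" "\<forall>t\<in>T Y. C \<in> t \<longleftrightarrow> F \<subseteq> t" by auto
  then show ?case using insert.prems
    by (intro exI[of _ "And B C"]) (auto simp: in_T_simps)
qed

lemma ex_disj:
  assumes "finite F" "\<forall>B\<in>F. vars B \<subseteq> Y"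
  shows "\<exists>C. vars C \<subseteq> Y \<and> (\<forall>t\<in>T Y. C \<in> t \<longleftrightarrow> (\<exists>B\<in>F. B \<in> t))"
  using assms
proof (induction F)
  case empty
  show ?case by (rule exI[of _ Falsum]) (auto simp: in_T_simps)
next
  case (insert B F)
  then obtain C where "vars C \<subseteq> Y" "\<forall>t\<in>T Y. C \<in> t \<longleftrightarrow> (\<exists>B\<in>F. B \<in> t)" by auto
  then show ?case using insert.prems
    by (intro exI[of _ "Or B C"]) (auto simp: in_T_simps)
qed

text \<open>Since \<open>T Y\<close> is finite, one can take the conjunction of one formula from
  \<open>t - s\<close> for each \<open>s\<close> that is not above \<open>t\<close>.\<close>

lemma definable_up:
  assumes Y: "finite Y" and t: "t \<in> T Y"
  shows "\<exists>C. vars C \<subseteq> Y \<and> (\<forall>s\<in>T Y. C \<in> s \<longleftrightarrow> t \<subseteq> s)"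
proof -
  define b where "b s = (SOME B. B \<in> t - s)" for s
  have b: "b s \<in> t - s" if "\<not> t \<subseteq> s" for s
    unfolding b_def using that by (metis Diff_eq_empty_iff some_in_eq)
  let ?F = "b ` {s \<in> T Y. \<not> t \<subseteq> s}"
  have "finite ?F" using finite_T[OF Y] by simp
  moreover have "\<forall>B\<in>?F. vars B \<subseteq> Y" using b vars_in_T[OF t] by blast
  ultimately have "\<exists>C. vars C \<subseteq> Y \<and> (\<forall>s\<in>T Y. C \<in> s \<longleftrightarrow> ?F \<subseteq> s)" by (rule ex_conj)
  then obtain C where C: "vars C \<subseteq> Y" "\<forall>s\<in>T Y. C \<in> s \<longleftrightarrow> ?F \<subseteq> s" by blast
  have "?F \<subseteq> s \<longleftrightarrow> t \<subseteq> s" if "s \<in> T Y" for s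
  proof
    assume F: "?F \<subseteq> s"
    show "t \<subseteq> s"
    proof (rule ccontr)
      assume "\<not> t \<subseteq> s"
      then show False using F b[of s] that by blast
    qed
  next
    assume "t \<subseteq> s"
    then show "?F \<subseteq> s" using b by auto
  qed
  then show ?thesis using C by (intro exI[of _ C]) simp
qed

lemma definable:
  assumes Y: "finite Y" and U: "U \<subseteq> T Y" "\<And>t. t \<in> U \<Longrightarrow> upT Y t \<subseteq> U"
  shows "\<exists>C. vars C \<subseteq> Y \<and> (\<forall>s\<in>T Y. C \<in> s \<longleftrightarrow> s \<in> U)"
proof -
  obtain b where b: "\<And>t. t \<in> T Y \<Longrightarrow> vars (b t) \<subseteq> Y \<and> (\<forall>s\<in>T Y. b t \<in> s \<longleftrightarrow> t \<subseteq> s)"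
    using definable_up[OF Y] by metis
  have "finite (b ` U)" "\<forall>B\<in>b ` U. vars B \<subseteq> Y"
    using finite_subset[OF U(1) finite_T[OF Y]] b U(1) by auto
  from ex_disj[OF this] obtain C where
    C: "vars C \<subseteq> Y" "\<forall>t\<in>T Y. C \<in> t \<longleftrightarrow> (\<exists>B\<in>b ` U. B \<in> t)" by blast
  have "(\<exists>B\<in>b ` U. B \<in> s) \<longleftrightarrow> s \<in> U" if "s \<in> T Y" for s
  proof
    assume "\<exists>B\<in>b ` U. B \<in> s"
    then obtain t where t: "t \<in> U" "b t \<in> s" by blast
    then have "s \<in> upT Y t" using b U(1) that unfolding upT_def by blast
    then show "s \<in> U" using U(2)[OF t(1)] by blast
  next
    assume "s \<in> U"
    then show "\<exists>B\<in>b ` U. B \<in> s" using b[OF that] that by blast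
  qed
  then show ?thesis using C by (intro exI[of _ C]) simp
qed

text \<open>For the back condition, let \<open>C\<close> define the upset of \<open>s\<close> and
  \<open>C'\<close> the same upset without \<open>s\<close>. As \<open>Imp C C'\<close> is not in
  \<open>s\<close>, it fails at \<open>w\<close>, and a point above \<open>w\<close> forcing
  \<open>C\<close> but not \<open>C'\<close> has exactly the theory \<open>s\<close>.\<close>

lemma p_morphism_th:
  assumes Y: "finite Y" and V: "persistent R V"
  shows "p_morphism (th Y V) (Field R) upR (T Y) (upT Y)"
  unfolding p_morphism_def
proof (intro ballI conjI)
  fix w assume w: "w \<in> Field R"
  show "th Y V w \<in> T Y" using V w by (rule th_in_T)
  show "upT Y (th Y V w) = th Y V ` upR w"
  proof
    show "th Y V ` upR w \<subseteq> upT Y (th Y V w)"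
      using forces_mono[OF V] th_in_T[OF V FieldI2] by (auto simp: upT_def upR_def th_def)
    show "upT Y (th Y V w) \<subseteq> th Y V ` upR w"
    proof
      fix s assume "s \<in> upT Y (th Y V w)"
      then have s: "s \<in> T Y" "th Y V w \<subseteq> s" by (auto simp: upT_def)
      obtain C where C: "vars C \<subseteq> Y" "\<forall>t\<in>T Y. C \<in> t \<longleftrightarrow> s \<subseteq> t" using definable_up[OF Y s(1)] by blast
      have "upT Y s - {s} \<subseteq> T Y" "\<And>t. t \<in> upT Y s - {s} \<Longrightarrow> upT Y t \<subseteq> upT Y s - {s}"
        unfolding upT_def by blast+
      from definable[OF Y this] obtain C'
        where C': "vars C' \<subseteq> Y" "\<forall>t\<in>T Y. C' \<in> t \<longleftrightarrow> t \<in> upT Y s - {s}" by blast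
      have "\<not> forces R V w (Imp C C')"
      proof
        assume F: "forces R V w (Imp C C')"
        then have "Imp C C' \<in> th Y V w" using C(1) C'(1) by (simp add: th_def)
        then have "Imp C C' \<in> s" using s(2) by blast
        moreover have "C \<in> s" "C' \<notin> s" using C C' s by auto
        moreover obtain V' w' where "w' \<in> Field R" "s = th Y V' w'" using s(1) by (auto elim: T_cases)
        ultimately show False using C(1) C'(1) refl_R by (auto simp: th_def)
      qed
      then obtain v where v: "(w, v) \<in> R" "forces R V v C" "\<not> forces R V v C'" by auto
      then have "th Y V v \<in> T Y" using th_in_T[OF V] by (blast intro: FieldI2)
      moreover have "C \<in> th Y V v" "C' \<notin> th Y V v" using v C(1) by (auto simp: th_def)
      ultimately have "th Y V v = s" using C(2) C'(2) unfolding upT_def by blast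
      then show "s \<in> th Y V ` upR w" using v by (auto simp: upR_def)
    qed
  qed
qed

lemma Imp_in_T:
  assumes Y: "finite Y" and t: "t \<in> T Y" and v: "vars A \<subseteq> Y" "vars B \<subseteq> Y"
  shows "Imp A B \<in> t \<longleftrightarrow> (\<forall>s\<in>upT Y t. A \<in> s \<longrightarrow> B \<in> s)"
proof -
  obtain V w where V: "persistent R V" "w \<in> Field R" "t = th Y V w" using t by (rule T_cases)
  have "upT Y t = th Y V ` upR w"
    using p_morphism_th[OF Y V(1)] V(2) unfolding p_morphism_def V(3) by blast
  then have "(\<forall>s\<in>upT Y t. A \<in> s \<longrightarrow> B \<in> s) \<longleftrightarrow> (\<forall>v\<in>upR w. A \<in> th Y V v \<longrightarrow> B \<in> th Y V v)"
    by simp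
  then show ?thesis using v by (auto simp: V(3) th_def upR_def)
qed

text \<open>A truth lemma for a p-morphism read as a valuation: in the case of an implication,
  \<open>Imp_in_T\<close> applies because \<open>g\<close> carries upsets onto upsets.\<close>

lemma th_eq_if_p_morphism:
  assumes Y: "finite Y" and U: "U \<subseteq> Field R" "\<And>u. u \<in> U \<Longrightarrow> upR u \<subseteq> U"
    and g: "p_morphism g U upR (T Y) (upT Y)"
    and V: "\<And>u x. u \<in> U \<Longrightarrow> x \<in> Y \<Longrightarrow> V u x \<longleftrightarrow> Var x \<in> g u"
    and u: "u \<in> U"
  shows "th Y V u = g u"
proof -
  have gT: "g u \<in> T Y" "upT Y (g u) = g ` upR u" if "u \<in> U" for u
    using g that by (auto simp: p_morphism_def)
  have "forces R V u B \<longleftrightarrow> B \<in> g u" if "vars B \<subseteq> Y" for B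
    using that u
  proof (induction B arbitrary: u)
    case (Imp A B)
    have "v \<in> U" if "v \<in> upR u" for v using U(2)[OF Imp.prems(2)] that by blast
    then show ?case
      using Imp Imp_in_T[OF Y gT(1)[OF Imp.prems(2)], of A B] gT(2)[OF Imp.prems(2)]
      by (auto simp: upR_def)
  qed (use V gT in \<open>simp_all add: in_T_simps[OF gT(1)]\<close>)
  then show ?thesis using vars_in_T[OF gT(1)[OF u]] unfolding th_def by blast
qed

text \<open>\<open>g\<close> is turned into a valuation above \<open>r\<close>, and making all
  variables false at \<open>r\<close> keeps it persistent. The theories above \<open>r\<close> are
  then the values of \<open>g\<close>, and the theory of \<open>r\<close> is the new point.\<close>

lemma ex_root:
  assumes Y: "finite Y" and r: "r \<in> Field R"
    and g: "p_morphism g (upR r - {r}) upR (T Y) (upT Y)"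
  shows "\<exists>p\<in>T Y. upT Y p = {p} \<union> g ` (upR r - {r})"
proof -
  let ?U = "upR r - {r}"
  let ?V = "\<lambda>u x. u \<in> ?U \<and> Var x \<in> g u"
  have U: "?U \<subseteq> Field R" by (auto simp: upR_def intro: FieldI2)
  have Uup: "upR u \<subseteq> ?U" if "u \<in> ?U" for u
    using that trans_R antisym_R by (auto simp: upR_def)
  have V: "persistent R ?V"
    unfolding persistent_def
  proof (intro allI impI)
    fix u v x assume uv: "(u, v) \<in> R" "u \<in> ?U \<and> Var x \<in> g u"
    then have "v \<in> upR u" by (simp add: upR_def)
    moreover from this have "g v \<in> upT Y (g u)" using g uv(2) by (auto simp: p_morphism_def)
    ultimately show "v \<in> ?U \<and> Var x \<in> g v" using uv Uup[of u] by (auto simp: upT_def)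
  qed
  have "th Y ?V u = g u" if "u \<in> ?U" for u
    by (rule th_eq_if_p_morphism[OF Y U Uup g _ that]) auto
  then have *: "th Y ?V ` ?U = g ` ?U" by (rule image_cong[OF refl])
  have "upT Y (th Y ?V r) = th Y ?V ` upR r"
    using p_morphism_th[OF Y V] r by (simp add: p_morphism_def)
  also have "\<dots> = {th Y ?V r} \<union> th Y ?V ` ?U" using r refl_R by (auto simp: upR_def)
  finally have "upT Y (th Y ?V r) = {th Y ?V r} \<union> g ` ?U" unfolding * .
  then show ?thesis using th_in_T[OF V r] by blast
qed

section \<open>Substitutions as p-morphisms between posets of theories\<close>

definition sub :: "nat set \<Rightarrow> substitution \<Rightarrow> fm set \<Rightarrow> fm set" where
  "sub X \<sigma> t = {B. vars B \<subseteq> X \<and> subst \<sigma> B \<in> t}"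

lemma vars_subst: "vars (subst \<sigma> A) = (\<Union>x\<in>vars A. vars (\<sigma> x))"
  by (induction A) auto

lemma forces_subst: "forces R V w (subst \<sigma> A) = forces R (\<lambda>w x. forces R V w (\<sigma> x)) w A"
  by (induction A arbitrary: w) auto

lemma persistent_subst: "persistent R V \<Longrightarrow> persistent R (\<lambda>w x. forces R V w (\<sigma> x))"
  using forces_mono by (auto simp: persistent_def)

lemma subst_in_logic: "A \<in> logic_of R \<Longrightarrow> subst \<sigma> A \<in> logic_of R"
  by (simp add: logic_of_def forces_subst persistent_subst)

lemma sub_th:
  assumes "\<forall>x\<in>X. vars (\<sigma> x) \<subseteq> Y"
  shows "sub X \<sigma> (th Y V w) = th X (\<lambda>w x. forces R V w (\<sigma> x)) w"
  using assms by (auto simp: sub_def th_def forces_subst vars_subst)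

text \<open>\<open>sub\<close> takes the theory of a point to its theory in the model interpreting
  each \<open>x\<close> by \<open>\<sigma> x\<close>, so \<open>p_morphism_th\<close> for the two
  models suffices.\<close>

lemma p_morphism_sub:
  assumes "finite X" "finite Y" and \<sigma>: "\<forall>x\<in>X. vars (\<sigma> x) \<subseteq> Y"
  shows "p_morphism (sub X \<sigma>) (T Y) (upT Y) (T X) (upT X)"
  unfolding p_morphism_def
proof (intro ballI)
  fix t assume "t \<in> T Y"
  then obtain V w where V: "persistent R V" "w \<in> Field R" "t = th Y V w" by (rule T_cases)
  let ?V = "\<lambda>w x. forces R V w (\<sigma> x)"
  note pm = p_morphism_th[OF assms(1) persistent_subst[OF V(1)], of \<sigma>] p_morphism_th[OF assms(2) V(1)]
  have "upT X (th X ?V w) = th X ?V ` upR w" "th X ?V w \<in> T X" "upT Y t = th Y V ` upR w"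
    using pm V by (auto simp: p_morphism_def)
  then show "sub X \<sigma> t \<in> T X \<and> upT X (sub X \<sigma> t) = sub X \<sigma> ` upT Y t"
    by (simp add: V(3) sub_th[OF \<sigma>] image_image)
qed

text \<open>A p-morphism is determined by the variables in its values, so formulas defining the
  corresponding upsets give a substitution that induces it.\<close>

lemma sub_eq_if_p_morphism:
  assumes "finite X" "finite Y" and f: "p_morphism f (T Y) (upT Y) (T X) (upT X)"
    and \<sigma>: "\<And>x. x \<in> X \<Longrightarrow> vars (\<sigma> x) \<subseteq> Y" "\<And>x t. x \<in> X \<Longrightarrow> t \<in> T Y \<Longrightarrow> \<sigma> x \<in> t \<longleftrightarrow> Var x \<in> f t"
    and t: "t \<in> T Y"
  shows "sub X \<sigma> t = f t"
proof -
  have fT: "f t \<in> T X" "upT X (f t) = f ` upT Y t" if "t \<in> T Y" for t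
    using f that by (auto simp: p_morphism_def)
  have vs: "vars (subst \<sigma> B) \<subseteq> Y" if "vars B \<subseteq> X" for B
    using that \<sigma>(1) by (auto simp: vars_subst)
  have "subst \<sigma> B \<in> t \<longleftrightarrow> B \<in> f t" if "vars B \<subseteq> X" for B
    using that t
  proof (induction B arbitrary: t)
    case (Imp A B)
    then have "Imp (subst \<sigma> A) (subst \<sigma> B) \<in> t \<longleftrightarrow>
        (\<forall>s\<in>upT Y t. subst \<sigma> A \<in> s \<longrightarrow> subst \<sigma> B \<in> s)"
      using vs by (intro Imp_in_T assms) auto
    also have "\<dots> \<longleftrightarrow> (\<forall>s\<in>upT Y t. A \<in> f s \<longrightarrow> B \<in> f s)"
      using Imp by (intro ball_cong refl) (auto simp: upT_def)
    also have "\<dots> \<longleftrightarrow> Imp A B \<in> f t"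
      using Imp Imp_in_T[OF assms(1) fT(1)[OF Imp.prems(2)], of A B] fT(2)[OF Imp.prems(2)] by auto
    finally show ?case by simp
  qed (use \<sigma> vs in \<open>simp_all add: in_T_simps[where Y = Y] in_T_simps[OF fT(1)]\<close>)
  then show ?thesis using vars_in_T[OF fT(1)[OF t]] unfolding sub_def by blast
qed

lemma structured_T:
  assumes "finite Y" "structured D (Field R) upR"
  shows "structured D (T Y) (upT Y)"
  unfolding structured_def
proof
  fix t assume "t \<in> T Y"
  then obtain V w where V: "persistent R V" "w \<in> Field R" "t = th Y V w" by (rule T_cases)
  note pm = p_morphism_th[OF assms(1) V(1)]
  have up: "upT Y (th Y V w) = th Y V ` upR w" if "w \<in> Field R" for w
    using pm that by (simp add: p_morphism_def)
  consider "forkish (Field R) upR w"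
    | a b where "joinable D (Field R) upR a b" "upR w = {w} \<union> upR a \<union> upR b"
    using assms(2) V(2) by (auto simp: structured_def)
  then show "forkish (T Y) (upT Y) t \<or>
      (\<exists>a b. joinable D (T Y) (upT Y) a b \<and> upT Y t = {t} \<union> upT Y a \<union> upT Y b)"
  proof cases
    case 1
    then show ?thesis using p_morphism_forkish[OF pm] V by simp
  next
    case 2
    then have "a \<in> Field R" "b \<in> Field R" by (auto simp: joinable_def forkish_def)
    then have "upT Y t = {t} \<union> upT Y (th Y V a) \<union> upT Y (th Y V b)"
      unfolding V(3) up[OF V(2)] up[OF \<open>a \<in> Field R\<close>] up[OF \<open>b \<in> Field R\<close>] 2(2) by (simp add: image_Un)
    then show ?thesis using p_morphism_joinable[OF pm poset_R 2(1)] by blast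
  qed
qed

end

section \<open>Finite complete sets of unifiers\<close>

lemma subst_cong: "(\<And>x. x \<in> vars A \<Longrightarrow> \<sigma> x = \<tau> x) \<Longrightarrow> subst \<sigma> A = subst \<tau> A"
  by (induction A) auto

lemma forkish_cover:
  assumes b: "forkish P up b" and t: "is_max up t" "t \<in> up b"
  shows "\<exists>m\<in>P. is_max up m \<and> up b = {b, m, t}"
proof -
  obtain m n where *: "b \<in> P" "m \<in> P" "n \<in> P" "is_max up m" "is_max up n" "up b = {b, m, n}"
    using b by (auto simp: forkish_def)
  consider "t = b" | "t = m" | "t = n" using t * by blast
  then show ?thesis
  proof cases
    case 1 then show ?thesis using t(1) *(1) by (intro bexI[of _ b]) (auto simp: is_max_def)
  next
    case 2 then show ?thesis using * by (intro bexI[of _ n]) auto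
  next
    case 3 then show ?thesis using * by (intro bexI[of _ m]) auto
  qed
qed

lemma amalgamating_max:
  assumes "amalgamating D P up" "m \<in> P" "n \<in> P" "is_max up m" "is_max up n"
  shows "\<exists>p\<in>P. up p = {p, m, n}"
  using assms by (simp add: amalgamating_def)

context kripke
begin

text \<open>The upset of \<open>r\<close> is isomorphic to \<open>G2\<close>. Stating this inside
  \<open>R\<close> covers both \<open>G2\<close> and its sum with \<open>C5\<close>.\<close>

definition G2_copy :: bool where
  "G2_copy \<longleftrightarrow> (\<exists>r a b c d. distinct [r, a, b, c, d] \<and> r \<in> Field R \<and> b \<in> Field R \<and> upR r = {r, a, b, c, d}
     \<and> upR a = {a} \<and> upR b = {b, c, d} \<and> upR c = {c} \<and> upR d = {d})"

definition C5_copy :: bool where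
  "C5_copy \<longleftrightarrow> (\<exists>r a b c t d. distinct [r, a, b, c, t, d] \<and> r \<in> Field R \<and> upR r = {r, a, b, c, t, d}
     \<and> upR a = {a, c, t} \<and> upR b = {b, t, d} \<and> upR c = {c} \<and> upR t = {t} \<and> upR d = {d})"

text \<open>The given points are placed on a copied frame without its root, and
  \<open>ex_root\<close> supplies the root: \<open>b\<close> for two maximal points, otherwise
  \<open>r\<close> of the copy of \<open>G2\<close> or \<open>C5\<close>.\<close>

lemma amalgamating_T:
  assumes Y: "finite Y" and G: G2_copy and C: "D \<Longrightarrow> C5_copy"
  shows "amalgamating D (T Y) (upT Y)"
proof -
  obtain r a b c d where ne: "distinct [r, a, b, c, d]" and rb: "r \<in> Field R" "b \<in> Field R"
    and up: "upR r = {r, a, b, c, d}" "upR a = {a}" "upR b = {b, c, d}" "upR c = {c}" "upR d = {d}"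
    using G unfolding G2_copy_def by blast
  have ne': "r \<noteq> a" "r \<noteq> b" "r \<noteq> c" "r \<noteq> d" "a \<noteq> b" "a \<noteq> c" "a \<noteq> d" "b \<noteq> c" "b \<noteq> d" "c \<noteq> d"
    using ne by auto
  show ?thesis
    unfolding amalgamating_def
  proof (intro conjI ballI allI impI)
    fix m n assume mn: "m \<in> T Y" "n \<in> T Y" "is_max (upT Y) m" "is_max (upT Y) n"
    let ?g = "\<lambda>w. if w = c then m else n"
    have st: "upR b - {b} = {c, d}" using ne' up by auto
    have "p_morphism ?g (upR b - {b}) upR (T Y) (upT Y)"
      using mn up ne' by (simp add: st p_morphism_def is_max_def)
    from ex_root[OF Y rb(2) this] show "\<exists>p\<in>T Y. upT Y p = {p, m, n}"
      using ne' by (auto simp: st insert_commute)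
  next
    fix x y assume xy: "joinable D (T Y) (upT Y) x y"
    then have f: "forkish (T Y) (upT Y) x" "forkish (T Y) (upT Y) y" by (auto simp: joinable_def)
    then have xyT: "x \<in> T Y" "y \<in> T Y" by (auto simp: forkish_def)
    show "\<exists>p\<in>T Y. upT Y p = {p} \<union> upT Y x \<union> upT Y y"
    proof (cases "is_max (upT Y) x")
      case True
      obtain m n where mn: "m \<in> T Y" "n \<in> T Y" "is_max (upT Y) m" "is_max (upT Y) n" "upT Y y = {y, m, n}"
        using f(2) by (auto simp: forkish_def)
      let ?g = "\<lambda>w. if w = a then x else if w = b then y else if w = c then m else n"
      have st: "upR r - {r} = {a, b, c, d}" using ne' up by auto
      have "p_morphism ?g (upR r - {r}) upR (T Y) (upT Y)"
        using mn up ne' xyT True by (auto simp: st p_morphism_def is_max_def)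
      from ex_root[OF Y rb(1) this] show ?thesis
        using ne' mn(5) True by (auto simp: st is_max_def insert_commute)
    next
      case False
      then obtain t where D and t: "is_max (upT Y) t" "t \<in> upT Y x" "t \<in> upT Y y"
        using xy by (auto simp: joinable_def)
      obtain m where m: "m \<in> T Y" "is_max (upT Y) m" "upT Y x = {x, m, t}"
        using forkish_cover[OF f(1) t(1,2)] by blast
      obtain n where n: "n \<in> T Y" "is_max (upT Y) n" "upT Y y = {y, n, t}"
        using forkish_cover[OF f(2) t(1,3)] by blast
      have tT: "t \<in> T Y" using t by (auto simp: upT_def)
      obtain r a b c s d where ne: "distinct [r, a, b, c, s, d]" and rF: "r \<in> Field R"
        and up: "upR r = {r, a, b, c, s, d}" "upR a = {a, c, s}" "upR b = {b, s, d}"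
          "upR c = {c}" "upR s = {s}" "upR d = {d}"
        using C[OF \<open>D\<close>] unfolding C5_copy_def by blast
      let ?g = "\<lambda>w. if w = a then x else if w = b then y else if w = c then m
        else if w = s then t else n"
      have st: "upR r - {r} = {a, b, c, s, d}" using ne up by auto
      have "p_morphism ?g (upR r - {r}) upR (T Y) (upT Y)"
        using m n t(1) tT up ne xyT by (auto simp: st p_morphism_def is_max_def)
      from ex_root[OF Y rF this] have "\<exists>p\<in>T Y. upT Y p = {p} \<union> ?g ` {a, b, c, s, d}"
        unfolding st .
      moreover have "?g ` {a, b, c, s, d} = {x, y, m, t, n}" using ne by auto
      moreover have "{x, y, m, t, n} = upT Y x \<union> upT Y y" unfolding m(3) n(3) by blast
      ultimately show ?thesis by (simp only: Un_assoc)
    qed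
  qed
qed

lemma Iff_in_logic:
  assumes "vars A \<subseteq> Y" "vars B \<subseteq> Y" "\<And>t. t \<in> T Y \<Longrightarrow> A \<in> t \<longleftrightarrow> B \<in> t"
  shows "Iff A B \<in> logic_of R"
proof -
  have "forces R V w A \<longleftrightarrow> forces R V w B" if "persistent R V" "w \<in> Field R" for V w
    using assms th_in_T[OF that, of Y] by (auto simp: th_def)
  then show ?thesis by (auto simp: logic_of_def Iff_def intro: FieldI2)
qed

lemma finite_complete_set:
  assumes st: "structured D (Field R) upR"
    and am: "\<And>Y. finite Y \<Longrightarrow> amalgamating D (T Y) (upT Y)"
  shows "\<exists>S. finite S \<and> complete_set_of_unifiers (logic_of R) A S"
proof -
  define X where "X = vars A"
  have X: "finite X" unfolding X_def by (induction A) auto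
  have finP: "finite (Pow (T X))" using finite_T[OF X] by simp
  \<comment> \<open>Fresh variables serving as colours, one for each subset of \<open>T X\<close>,
    that is, for each possible value of \<open>E\<close> below.\<close>
  obtain B where B: "finite B" "card B = card (Pow (T X))" "B \<subseteq> UNIV - X"
    using infinite_arbitrarily_large[of "UNIV - X" "card (Pow (T X))"] X by auto
  obtain c where c: "bij_betw c (Pow (T X)) B"
    using finite_same_card_bij[OF finP B(1)] B(2) by auto
  define Z where "Z = X \<union> B"
  have Z: "finite Z" using X B by (simp add: Z_def)
  have "\<exists>C. U \<subseteq> T Z \<longrightarrow> (\<forall>t\<in>U. upT Z t \<subseteq> U) \<longrightarrow> vars C \<subseteq> Z \<and> (\<forall>s\<in>T Z. C \<in> s \<longleftrightarrow> s \<in> U)" for U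
    using definable[OF Z, of U] by blast
  \<comment> \<open>Fixing one defining formula per upset of \<open>T Z\<close> makes the set of
    candidates finite and independent of the unifier.\<close>
  then obtain dZ where dZ: "\<And>U. U \<subseteq> T Z \<Longrightarrow> \<forall>t\<in>U. upT Z t \<subseteq> U \<Longrightarrow>
      vars (dZ U) \<subseteq> Z \<and> (\<forall>s\<in>T Z. dZ U \<in> s \<longleftrightarrow> s \<in> U)" by metis
  \<comment> \<open>Unifiers are compared on \<open>X\<close> only; the constant value
    \<open>Falsum\<close> elsewhere keeps \<open>F\<close> finite.\<close>
  define F where "F = {\<epsilon>. \<forall>x. (x \<in> X \<longrightarrow> \<epsilon> x \<in> dZ ` Pow (T Z)) \<and> (x \<notin> X \<longrightarrow> \<epsilon> x = Falsum)}"
  have "finite F" unfolding F_def using X finite_T[OF Z] by (intro finite_set_of_finite_funs) auto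
  moreover have "complete_set_of_unifiers (logic_of R) A {\<epsilon> \<in> F. unifier (logic_of R) A \<epsilon>}"
    unfolding complete_set_of_unifiers_def
  proof (intro conjI ballI allI impI)
    fix \<mu> assume \<mu>: "unifier (logic_of R) A \<mu>"
    define Y where "Y = (\<Union>x\<in>X. vars (\<mu> x))"
    have fv: "finite (vars C)" for C by (induction C) auto
    have Y: "finite Y" using X fv by (auto simp: Y_def)
    have \<mu>Y: "\<forall>x\<in>X. vars (\<mu> x) \<subseteq> Y" by (auto simp: Y_def)
    define h where "h = sub X \<mu>"
    define E where "E m = h ` {b. forkish (T Y) (upT Y) b \<and> m \<in> upT Y b}" for m
    have h: "p_morphism h (T Y) (upT Y) (T X) (upT X)"
      unfolding h_def by (rule p_morphism_sub[OF X Y \<mu>Y])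
    have ET: "E m \<in> Pow (T X)" for m
      using h by (auto simp: E_def forkish_def p_morphism_def)
    \<comment> \<open>The maximal points of one colour form an upset, so a formula over
      \<open>Y\<close> defines them; \<open>\<alpha>\<close> will substitute it for the colour
      variable.\<close>
    define U where "U e = {m \<in> T Y. is_max (upT Y) m \<and> E m = e}" for e
    have "\<exists>C. vars C \<subseteq> Y \<and> (\<forall>s\<in>T Y. C \<in> s \<longleftrightarrow> s \<in> U e)" for e
      by (rule definable[OF Y]) (auto simp: U_def is_max_def)
    then obtain \<delta> where \<delta>: "\<And>e. vars (\<delta> e) \<subseteq> Y" "\<And>e s. s \<in> T Y \<Longrightarrow> \<delta> e \<in> s \<longleftrightarrow> s \<in> U e" by metis
    define \<alpha> where "\<alpha> z = (if z \<in> X then \<mu> z else \<delta> (inv_into (Pow (T X)) c z))" for z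
    have \<alpha>c: "\<alpha> (c e) = \<delta> e" "c e \<in> Z" if "e \<in> Pow (T X)" for e
    proof -
      have "c e \<in> B" using c that by (auto simp: bij_betw_def)
      then show "c e \<in> Z" "\<alpha> (c e) = \<delta> e"
        using B(3) that c by (auto simp: Z_def \<alpha>_def bij_betw_def inv_into_f_f)
    qed
    have \<alpha>Y: "\<forall>z\<in>Z. vars (\<alpha> z) \<subseteq> Y" using \<mu>Y \<delta>(1) by (auto simp: \<alpha>_def)
    define k where "k = sub Z \<alpha>"
    have k: "p_morphism k (T Y) (upT Y) (T Z) (upT Z)"
      unfolding k_def by (rule p_morphism_sub[OF Z Y \<alpha>Y])
    have kc: "Var (c e) \<in> k p \<longleftrightarrow> is_max (upT Y) p \<and> E p = e" if "p \<in> T Y" "e \<in> Pow (T X)" for p e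
      using \<alpha>c[OF that(2)] \<delta>(2)[OF that(1), of e] that(1) by (simp add: k_def sub_def U_def)
    have kh: "h p = h p'" if "p \<in> T Y" "p' \<in> T Y" "k p = k p'" for p p'
    proof -
      have "subst \<alpha> C = subst \<mu> C" if "vars C \<subseteq> X" for C
        using that by (intro subst_cong) (auto simp: \<alpha>_def)
      then have "h p = {C \<in> k p. vars C \<subseteq> X}" for p by (auto simp: h_def k_def sub_def Z_def)
      then show ?thesis using that(3) by simp
    qed
    have kE: "E p = E p'"
      if "p \<in> T Y" "p' \<in> T Y" "is_max (upT Y) p" "is_max (upT Y) p'" "k p = k p'" for p p'
      using kc[OF that(1) ET[of p]] kc[OF that(2) ET[of p]] that by simp
    \<comment> \<open>A maximal \<open>q\<close> above \<open>p\<close> has the same image as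
      \<open>p\<close>. The colour variable of \<open>q\<close> is therefore in \<open>k p\<close>,
      and colours occur at maximal points only.\<close>
    have kr: "is_max (upT Y) p" if p: "p \<in> T Y" "is_max (upT Z) (k p)" for p
    proof -
      obtain q where q: "q \<in> upT Y p" "is_max (upT Y) q"
        using ex_max_above[OF poset_T finite_T[OF Y] p(1)] by blast
      then have "q \<in> T Y" by (simp add: upT_def)
      moreover have "k q \<in> upT Z (k p)" using q(1) k p(1) by (auto simp: p_morphism_def)
      then have "k q = k p" using p(2) by (simp add: is_max_def)
      ultimately show ?thesis using kc[of q "E q"] kc[OF p(1), of "E q"] ET[of q] q(2) by simp
    qed
    obtain f where f: "p_morphism f (T Z) (upT Z) (T X) (upT X)"
      and fk: "\<And>p. p \<in> T Y \<Longrightarrow> f (k p) = h p" and fim: "f ` T Z \<subseteq> h ` T Y"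
      using extension[OF poset_T finite_T[OF Y] T_nonempty structured_T[OF Y st] am[OF Y]
          poset_T structured_T[OF Z st] k h kr kh kE[unfolded E_def]] by blast
    define \<epsilon> where "\<epsilon> x = (if x \<in> X then dZ {t \<in> T Z. Var x \<in> f t} else Falsum)" for x
    have \<epsilon>: "vars (\<epsilon> x) \<subseteq> Z" "t \<in> T Z \<Longrightarrow> \<epsilon> x \<in> t \<longleftrightarrow> Var x \<in> f t" if "x \<in> X" for x t
    proof -
      have "\<forall>t\<in>{t \<in> T Z. Var x \<in> f t}. upT Z t \<subseteq> {t \<in> T Z. Var x \<in> f t}"
      proof (intro ballI subsetI)
        fix t s assume ts: "t \<in> {t \<in> T Z. Var x \<in> f t}" "s \<in> upT Z t"
        then have "f s \<in> upT X (f t)" using f by (auto simp: p_morphism_def)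
        then show "s \<in> {t \<in> T Z. Var x \<in> f t}" using ts by (auto simp: upT_def)
      qed
      from dZ[OF _ this] show "vars (\<epsilon> x) \<subseteq> Z" "t \<in> T Z \<Longrightarrow> \<epsilon> x \<in> t \<longleftrightarrow> Var x \<in> f t"
        using that by (auto simp: \<epsilon>_def)
    qed
    have sub\<epsilon>: "sub X \<epsilon> t = f t" if "t \<in> T Z" for t
      by (rule sub_eq_if_p_morphism[OF X Z f \<epsilon> that])
    have "\<epsilon> \<in> F" by (auto simp: F_def \<epsilon>_def)
    \<comment> \<open>The values of \<open>f\<close> are among those of \<open>h\<close>, and these
      contain \<open>A\<close> because \<open>\<mu>\<close> unifies it.\<close>
    moreover have "unifier (logic_of R) A \<epsilon>"
    proof -
      have "subst \<epsilon> A \<in> t" if t: "t \<in> T Z" for t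
      proof -
        obtain p where p: "p \<in> T Y" "f t = sub X \<mu> p" using fim t by (auto simp: h_def)
        have "vars (subst \<mu> A) \<subseteq> Y" using \<mu>Y by (auto simp: vars_subst X_def)
        then have "subst \<mu> A \<in> p" using \<mu> p(1) in_logic_iff by (auto simp: unifier_def)
        then have "A \<in> sub X \<epsilon> t" unfolding sub\<epsilon>[OF t] p(2) by (simp add: sub_def X_def)
        then show ?thesis by (simp add: sub_def)
      qed
      moreover have "vars (subst \<epsilon> A) \<subseteq> Z" using \<epsilon>(1) by (auto simp: vars_subst X_def)
      ultimately show ?thesis using in_logic_iff by (auto simp: unifier_def)
    qed
    \<comment> \<open>Dually this is \<open>f (k p) = h p\<close>: the substitutions
      \<open>\<epsilon>\<close>, \<open>\<alpha>\<close> and \<open>\<mu>\<close> induce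
      \<open>f\<close>, \<open>k\<close> and \<open>h\<close>.\<close>
    moreover have "subst_eq (logic_of R) (vars A) (subst_comp \<alpha> \<epsilon>) \<mu>"
      unfolding subst_eq_def subst_comp_def
    proof
      fix x assume "x \<in> vars A"
      then have x: "x \<in> X" by (simp add: X_def)
      show "Iff (subst \<alpha> (\<epsilon> x)) (\<mu> x) \<in> logic_of R"
      proof (rule Iff_in_logic)
        show "vars (subst \<alpha> (\<epsilon> x)) \<subseteq> Y" using \<epsilon>(1)[OF x] \<alpha>Y by (auto simp: vars_subst)
        show "vars (\<mu> x) \<subseteq> Y" using \<mu>Y x by blast
        fix t assume t: "t \<in> T Y"
        then have kt: "k t \<in> T Z" using k by (simp add: p_morphism_def)
        have "subst \<alpha> (\<epsilon> x) \<in> t \<longleftrightarrow> \<epsilon> x \<in> k t" using \<epsilon>(1)[OF x] by (simp add: k_def sub_def)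
        also have "\<dots> \<longleftrightarrow> Var x \<in> h t" using \<epsilon>(2)[OF x kt] fk[OF t] by simp
        also have "\<dots> \<longleftrightarrow> \<mu> x \<in> t" using x by (simp add: h_def sub_def)
        finally show "subst \<alpha> (\<epsilon> x) \<in> t \<longleftrightarrow> \<mu> x \<in> t" .
      qed
    qed
    ultimately show "\<exists>\<epsilon>\<in>{\<epsilon> \<in> F. unifier (logic_of R) A \<epsilon>}. \<exists>\<alpha>.
        subst_eq (logic_of R) (vars A) (subst_comp \<alpha> \<epsilon>) \<mu>" by blast
  qed simp
  ultimately show ?thesis by (metis (no_types, lifting) finite_subset mem_Collect_eq subsetI)
qed

text \<open>\<open>x \<or> \<not> x\<close> is unified by the two constants, but amalgamation gives the disjunction property
  for \<open>B \<or> \<not> B\<close>.\<close>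

lemma not_unitary:
  assumes am: "\<And>Y. finite Y \<Longrightarrow> amalgamating D (T Y) (upT Y)"
  shows "\<not> unitary_unification (logic_of R)"
proof
  let ?A = "Or (Var 0) (Imp (Var 0) Falsum)"
  let ?t = "\<lambda>_. Imp Falsum Falsum" and ?f = "\<lambda>_. Falsum"
  assume u: "unitary_unification (logic_of R)"
  have tf: "unifier (logic_of R) ?A ?t" "unifier (logic_of R) ?A ?f"
    by (auto simp: unifier_def logic_of_def)
  then have "unifiable (logic_of R) ?A" unfolding unifiable_def by blast
  then obtain \<epsilon> where e: "complete_set_of_unifiers (logic_of R) ?A {\<epsilon>}"
    using u unfolding unitary_unification_def by blast
  obtain \<alpha> where \<alpha>: "subst_eq (logic_of R) (vars ?A) (subst_comp \<alpha> \<epsilon>) ?t"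
    using e tf(1) unfolding complete_set_of_unifiers_def by blast
  obtain \<beta> where \<beta>: "subst_eq (logic_of R) (vars ?A) (subst_comp \<beta> \<epsilon>) ?f"
    using e tf(2) unfolding complete_set_of_unifiers_def by blast
  define B where "B = \<epsilon> 0"
  define N where "N = Imp B Falsum"
  define Y where "Y = vars B"
  have Y: "finite Y" unfolding Y_def by (induction B) auto
  have v: "vars B \<subseteq> Y" "vars N \<subseteq> Y" "vars Falsum \<subseteq> Y" by (auto simp: N_def Y_def)
  have "Or B N \<in> logic_of R"
    using e by (simp add: complete_set_of_unifiers_def unifier_def B_def N_def)
  then have BN: "B \<in> t \<or> N \<in> t" if "t \<in> T Y" for t
    using in_logic_iff[of "Or B N" Y] v that in_T_simps(3)[OF that] by auto
  have cons: "\<not> (B \<in> t \<and> N \<in> t)" if "t \<in> T Y" for t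
    using Imp_in_T[OF Y that v(1,3)] in_T_simps(1)[OF that] that by (auto simp: N_def upT_def)
  obtain w where w: "w \<in> Field R" "(w, w) \<in> R" using nonempty refl_R by blast
  have w_forces: "forces R (\<lambda>_ _. False) w C" if "C \<in> logic_of R" for C
    using that w(1) by (simp add: logic_of_def persistent_def)
  have "B \<notin> logic_of R"
  proof
    assume "B \<in> logic_of R"
    then have "subst \<beta> B \<in> logic_of R" by (rule subst_in_logic)
    moreover have "Iff (subst \<beta> B) Falsum \<in> logic_of R"
      using \<beta> by (simp add: subst_eq_def subst_comp_def B_def)
    ultimately show False using w_forces[of "subst \<beta> B"] w_forces[of "Iff (subst \<beta> B) Falsum"] w
      by (auto simp: Iff_def)
  qed
  then obtain s where s: "s \<in> T Y" "B \<notin> s" using in_logic_iff[OF v(1)] by blast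
  have "N \<notin> logic_of R"
  proof
    assume "N \<in> logic_of R"
    then have "subst \<alpha> N \<in> logic_of R" by (rule subst_in_logic)
    moreover have "Iff (subst \<alpha> B) (Imp Falsum Falsum) \<in> logic_of R"
      using \<alpha> by (simp add: subst_eq_def subst_comp_def B_def)
    ultimately show False using w_forces[of "subst \<alpha> N"]
        w_forces[of "Iff (subst \<alpha> B) (Imp Falsum Falsum)"] w
      by (auto simp: Iff_def N_def)
  qed
  then obtain t where t: "t \<in> T Y" "N \<notin> t" using in_logic_iff[OF v(2)] by blast
  obtain m where m: "m \<in> upT Y s" "is_max (upT Y) m"
    using ex_max_above[OF poset_T finite_T[OF Y] s(1)] by blast
  obtain n where n: "n \<in> upT Y t" "is_max (upT Y) n"
    using ex_max_above[OF poset_T finite_T[OF Y] t(1)] by blast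
  have mn: "m \<in> T Y" "n \<in> T Y" "N \<in> m" "B \<in> n"
    using m n BN[OF s(1)] BN[OF t(1)] s t by (auto simp: upT_def)
  \<comment> \<open>\<open>m\<close> contains \<open>N\<close> and \<open>n\<close> contains
    \<open>B\<close>, so by \<open>cons\<close> a point below both contains neither, against
    \<open>BN\<close>.\<close>
  obtain p where p: "p \<in> T Y" "upT Y p = {p, m, n}"
    using amalgamating_max[OF am[OF Y] mn(1,2) m(2) n(2)] by blast
  then have "p \<subseteq> m" "p \<subseteq> n" unfolding upT_def by blast+
  then show False using BN[OF p(1)] cons mn by blast
qed

lemma finitary:
  assumes "structured D (Field R) upR" G2_copy "D \<Longrightarrow> C5_copy"
  shows "finitary_unification (logic_of R)"
proof -
  have am: "amalgamating D (T Y) (upT Y)" if "finite Y" for Y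
    using amalgamating_T[OF that assms(2,3)] .
  show ?thesis
    unfolding finitary_unification_def
    using not_unitary[OF am] finite_complete_set[OF assms(1) am] by blast
qed

end

section \<open>The two frames\<close>

lemma Image_G2:
  "G2 `` {G_r} = {G_r, G_a, G_b, G_c, G_d}" "G2 `` {G_a} = {G_a}"
  "G2 `` {G_b} = {G_b, G_c, G_d}" "G2 `` {G_c} = {G_c}" "G2 `` {G_d} = {G_d}"
  by (auto simp: G2_eq)

lemma Image_C5:
  "C5 `` {C_r} = {C_r, C_a, C_b, C_c, C_t, C_d}" "C5 `` {C_a} = {C_a, C_c, C_t}"
  "C5 `` {C_b} = {C_b, C_t, C_d}" "C5 `` {C_c} = {C_c}" "C5 `` {C_t} = {C_t}" "C5 `` {C_d} = {C_d}"
  by (auto simp: C5_eq)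

section \<open>Disjoint sums of frames and intersections of logics\<close>

definition sum_rel :: "'a rel \<Rightarrow> 'b rel \<Rightarrow> ('a + 'b) rel" where
  "sum_rel Q S = map_prod Inl Inl ` Q \<union> map_prod Inr Inr ` S"

lemma in_sum_rel [simp]:
  "(Inl u, Inl v) \<in> sum_rel Q S \<longleftrightarrow> (u, v) \<in> Q"
  "(Inr u', Inr v') \<in> sum_rel Q S \<longleftrightarrow> (u', v') \<in> S"
  "(Inl u, Inr v') \<notin> sum_rel Q S" "(Inr u', Inl v) \<notin> sum_rel Q S"
  by (auto simp: sum_rel_def)

lemma Image_sum_rel:
  "sum_rel Q S `` {Inl u} = Inl ` (Q `` {u})" "sum_rel Q S `` {Inr u'} = Inr ` (S `` {u'})"
  by (auto simp: sum_rel_def)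

lemma Field_sum_rel: "Field (sum_rel Q S) = Field Q <+> Field S"
  by (auto simp: sum_rel_def Field_def)

lemma forces_sum_rel:
  "forces (sum_rel Q S) V (Inl u) A = forces Q (\<lambda>w. V (Inl w)) u A"
  "forces (sum_rel Q S) V (Inr u') A = forces S (\<lambda>w. V (Inr w)) u' A"
proof (induction A arbitrary: u u')
  case (Imp A B)
  have l: "(\<forall>v. (Inl u, v) \<in> sum_rel Q S \<longrightarrow> F v) \<longleftrightarrow> (\<forall>v. (u, v) \<in> Q \<longrightarrow> F (Inl v))" for F u
    by (metis in_sum_rel(1,3) sum.exhaust)
  have r: "(\<forall>v. (Inr u, v) \<in> sum_rel Q S \<longrightarrow> F v) \<longleftrightarrow> (\<forall>v. (u, v) \<in> S \<longrightarrow> F (Inr v))" for F u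
    by (metis in_sum_rel(2,4) sum.exhaust)
  {
    case 1 show ?case by (simp add: l Imp)
  next
    case 2 show ?case by (simp add: r Imp)
  }
qed simp_all

lemma persistent_sum_rel:
  "persistent (sum_rel Q S) (case_sum V V') \<longleftrightarrow> persistent Q V \<and> persistent S V'"
proof
  show "persistent (sum_rel Q S) (case_sum V V') \<Longrightarrow> persistent Q V \<and> persistent S V'"
    unfolding persistent_def by (metis in_sum_rel(1,2) old.sum.simps(5,6))
  show "persistent Q V \<and> persistent S V' \<Longrightarrow> persistent (sum_rel Q S) (case_sum V V')"
    by (auto simp: persistent_def sum_rel_def)
qed

lemma logic_of_sum_rel: "logic_of (sum_rel Q S) = logic_of Q \<inter> logic_of S"
proof (intro equalityI subsetI IntI)
  fix A assume A: "A \<in> logic_of (sum_rel Q S)"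
  have *: "forces (sum_rel Q S) (case_sum V V') w A"
    if "persistent Q V" "persistent S V'" "w \<in> Field Q <+> Field S" for V V' w
    using A that persistent_sum_rel[of Q S V V'] by (simp add: logic_of_def Field_sum_rel)
  \<comment> \<open>A model on one summand is completed by the all-false valuation on the
    other.\<close>
  have F: "persistent Q (\<lambda>_ _. False)" "persistent S (\<lambda>_ _. False)" by (auto simp: persistent_def)
  show "A \<in> logic_of Q"
    using *[OF _ F(2) InlI] by (auto simp: logic_of_def forces_sum_rel)
  show "A \<in> logic_of S"
    using *[OF F(1) _ InrI] by (auto simp: logic_of_def forces_sum_rel)
next
  fix A assume A: "A \<in> logic_of Q \<inter> logic_of S"
  show "A \<in> logic_of (sum_rel Q S)"
    unfolding logic_of_def
  proof (intro CollectI allI impI ballI)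
    fix V w assume V: "persistent (sum_rel Q S) V" and w: "w \<in> Field (sum_rel Q S)"
    have "V = case_sum (\<lambda>u. V (Inl u)) (\<lambda>u. V (Inr u))" by (auto split: sum.split)
    then have "persistent Q (\<lambda>u. V (Inl u))" "persistent S (\<lambda>u. V (Inr u))"
      using V persistent_sum_rel by metis+
    then show "forces (sum_rel Q S) V w A"
      using A w by (auto simp: logic_of_def forces_sum_rel Field_sum_rel)
  qed
qed

lemma Partial_order_sum_rel:
  assumes "Partial_order Q" "Partial_order S"
  shows "Partial_order (sum_rel Q S)"
proof -
  have "refl_on (Field (sum_rel Q S)) (sum_rel Q S)"
    using assms by (auto simp: refl_on_def Field_sum_rel partial_order_on_def preorder_on_def)
  moreover have "trans (sum_rel Q S)"
    using assms unfolding partial_order_on_def preorder_on_def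
    by (intro transI) (auto simp: sum_rel_def dest: transD)
  moreover have "antisym (sum_rel Q S)"
    using assms unfolding partial_order_on_def
    by (intro antisymI) (auto simp: sum_rel_def dest: antisymD)
  ultimately show ?thesis
    by (auto simp: partial_order_on_def preorder_on_def sum_rel_def intro: FieldI1 FieldI2)
qed

interpretation G2: kripke G2
  using frame_G2 by unfold_locales (auto simp: frame_def)

interpretation G2C5: kripke "sum_rel G2 C5"
proof
  show "finite (Field (sum_rel G2 C5))"
    using frame_G2 frame_C5 by (simp add: Field_sum_rel frame_def)
  show "Partial_order (sum_rel G2 C5)"
    using frame_G2 frame_C5 by (simp add: frame_def Partial_order_sum_rel)
  show "Field (sum_rel G2 C5) \<noteq> {}"
    by (simp add: Field_sum_rel Field_G2 Field_C5)
qed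

lemma forkishI:
  "b \<in> P \<Longrightarrow> m \<in> P \<Longrightarrow> n \<in> P \<Longrightarrow> is_max up m \<Longrightarrow> is_max up n \<Longrightarrow> up b = {b, m, n} \<Longrightarrow> forkish P up b"
  by (auto simp: forkish_def)

text \<open>The instance \<open>D = False\<close>: the root joins a maximal point with a fork, and
  all other points are forkish.\<close>

lemma finitary_G2: "finitary_unification (logic_of G2)"
proof (rule G2.finitary)
  have M: "is_max G2.upR G_a" "is_max G2.upR G_c" "is_max G2.upR G_d"
    by (auto simp: is_max_def G2.upR_def Image_G2)
  have a: "forkish UNIV G2.upR G_a" by (rule max_forkish[OF UNIV_I M(1)])
  have b: "forkish UNIV G2.upR G_b"
    by (rule forkishI[OF UNIV_I UNIV_I UNIV_I M(2,3)]) (simp add: G2.upR_def Image_G2)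
  have r: "joinable False UNIV G2.upR G_a G_b" using a b M by (simp add: joinable_def)
  show "structured False (Field G2) G2.upR"
    unfolding structured_def Field_G2
  proof
    fix q :: g2_world
    show "forkish UNIV G2.upR q \<or>
      (\<exists>a b. joinable False UNIV G2.upR a b \<and> G2.upR q = {q} \<union> G2.upR a \<union> G2.upR b)"
    proof (cases q)
      case G_r
      then have "G2.upR q = {q} \<union> G2.upR G_a \<union> G2.upR G_b"
        by (auto simp: G2.upR_def Image_G2)
      then show ?thesis using r by blast
    qed (use a b max_forkish[OF UNIV_I M(2)] max_forkish[OF UNIV_I M(3)] in auto)
  qed
  show G2.G2_copy
    unfolding G2.G2_copy_def G2.upR_def Field_G2
    by (rule exI[of _ G_r], rule exI[of _ G_a], rule exI[of _ G_b], rule exI[of _ G_c], rule exI[of _ G_d])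
      (simp add: Image_G2)
qed simp

text \<open>The instance \<open>D = True\<close>: the root of the \<open>C5\<close> summand joins
  two forks sharing the maximal point \<open>C_t\<close>.\<close>

lemma finitary_G2_C5: "finitary_unification (logic_of G2 \<inter> logic_of C5)"
proof -
  let ?R = "sum_rel G2 C5"
  have F: "Field ?R = UNIV" by (simp add: Field_sum_rel Field_G2 Field_C5)
  note up = G2C5.upR_def Image_sum_rel Image_G2 Image_C5
  have M: "is_max G2C5.upR (Inl G_a)" "is_max G2C5.upR (Inl G_c)" "is_max G2C5.upR (Inl G_d)"
    "is_max G2C5.upR (Inr C_c)" "is_max G2C5.upR (Inr C_t)" "is_max G2C5.upR (Inr C_d)"
    by (auto simp: is_max_def up)
  note f = M[THEN max_forkish[OF UNIV_I]]
  have b: "forkish UNIV G2C5.upR (Inl G_b)"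
    by (rule forkishI[OF UNIV_I UNIV_I UNIV_I M(2,3)]) (simp add: up)
  have c5: "forkish UNIV G2C5.upR (Inr C_a)" "forkish UNIV G2C5.upR (Inr C_b)"
    by (rule forkishI[OF UNIV_I UNIV_I UNIV_I M(4,5)] forkishI[OF UNIV_I UNIV_I UNIV_I M(5,6)], simp add: up)+
  have r: "joinable True UNIV G2C5.upR (Inl G_a) (Inl G_b)" using f b M by (simp add: joinable_def)
  have r': "joinable True UNIV G2C5.upR (Inr C_a) (Inr C_b)"
    unfolding joinable_def using c5 M(5) by (auto simp: up)
  have "finitary_unification (logic_of ?R)"
  proof (rule G2C5.finitary)
    show "structured True (Field ?R) G2C5.upR"
      unfolding structured_def F
    proof
      fix q :: "g2_world + c5_world"
      show "forkish UNIV G2C5.upR q \<or>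
        (\<exists>a b. joinable True UNIV G2C5.upR a b \<and> G2C5.upR q = {q} \<union> G2C5.upR a \<union> G2C5.upR b)"
      proof (cases q)
        case q: (Inl x)
        show ?thesis
        proof (cases x)
          case G_r
          then have "G2C5.upR q = {q} \<union> G2C5.upR (Inl G_a) \<union> G2C5.upR (Inl G_b)"
            by (auto simp: up q)
          then show ?thesis using r by blast
        qed (use b f q in auto)
      next
        case q: (Inr x)
        show ?thesis
        proof (cases x)
          case C_r
          then have "G2C5.upR q = {q} \<union> G2C5.upR (Inr C_a) \<union> G2C5.upR (Inr C_b)"
            by (auto simp: up q)
          then show ?thesis using r' by blast
        qed (use c5 f q in auto)
      qed
    qed
    show G2C5.G2_copy
      unfolding G2C5.G2_copy_def F
      by (rule exI[of _ "Inl G_r"], rule exI[of _ "Inl G_a"], rule exI[of _ "Inl G_b"],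
          rule exI[of _ "Inl G_c"], rule exI[of _ "Inl G_d"]) (simp add: up)
    show G2C5.C5_copy
      unfolding G2C5.C5_copy_def F
      by (rule exI[of _ "Inr C_r"], rule exI[of _ "Inr C_a"], rule exI[of _ "Inr C_b"],
          rule exI[of _ "Inr C_c"], rule exI[of _ "Inr C_t"], rule exI[of _ "Inr C_d"]) (simp add: up)
  qed
  then show ?thesis by (simp add: logic_of_sum_rel)
qed

section \<open>No projective approximation\<close>

lemma all_above: "(\<forall>v. (w, v) \<in> R \<longrightarrow> F v) \<longleftrightarrow> (\<forall>v\<in>R `` {w}. F v)"
  by auto

lemma ex_above: "(\<exists>v. (w, v) \<in> R \<and> F v) \<longleftrightarrow> (\<exists>v\<in>R `` {w}. F v)"
  by auto

lemma all_G2: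
  "(\<forall>v. (G_r, v) \<in> G2 \<longrightarrow> F v) \<longleftrightarrow> F G_r \<and> F G_a \<and> F G_b \<and> F G_c \<and> F G_d"
  "(\<forall>v. (G_a, v) \<in> G2 \<longrightarrow> F v) \<longleftrightarrow> F G_a"
  "(\<forall>v. (G_b, v) \<in> G2 \<longrightarrow> F v) \<longleftrightarrow> F G_b \<and> F G_c \<and> F G_d"
  "(\<forall>v. (G_c, v) \<in> G2 \<longrightarrow> F v) \<longleftrightarrow> F G_c"
  "(\<forall>v. (G_d, v) \<in> G2 \<longrightarrow> F v) \<longleftrightarrow> F G_d"
  unfolding all_above Image_G2 by simp_all

lemma all_C5:
  "(\<forall>v. (C_r, v) \<in> C5 \<longrightarrow> F v) \<longleftrightarrow> F C_r \<and> F C_a \<and> F C_b \<and> F C_c \<and> F C_t \<and> F C_d"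
  "(\<forall>v. (C_a, v) \<in> C5 \<longrightarrow> F v) \<longleftrightarrow> F C_a \<and> F C_c \<and> F C_t"
  "(\<forall>v. (C_b, v) \<in> C5 \<longrightarrow> F v) \<longleftrightarrow> F C_b \<and> F C_t \<and> F C_d"
  "(\<forall>v. (C_c, v) \<in> C5 \<longrightarrow> F v) \<longleftrightarrow> F C_c"
  "(\<forall>v. (C_t, v) \<in> C5 \<longrightarrow> F v) \<longleftrightarrow> F C_t"
  "(\<forall>v. (C_d, v) \<in> C5 \<longrightarrow> F v) \<longleftrightarrow> F C_d"
  unfolding all_above Image_C5 by simp_all

lemma ex_G2:
  "(\<exists>v. (G_r, v) \<in> G2 \<and> F v) \<longleftrightarrow> F G_r \<or> F G_a \<or> F G_b \<or> F G_c \<or> F G_d"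
  "(\<exists>v. (G_a, v) \<in> G2 \<and> F v) \<longleftrightarrow> F G_a"
  "(\<exists>v. (G_b, v) \<in> G2 \<and> F v) \<longleftrightarrow> F G_b \<or> F G_c \<or> F G_d"
  "(\<exists>v. (G_c, v) \<in> G2 \<and> F v) \<longleftrightarrow> F G_c"
  "(\<exists>v. (G_d, v) \<in> G2 \<and> F v) \<longleftrightarrow> F G_d"
  unfolding ex_above Image_G2 by simp_all

lemma ex_C5:
  "(\<exists>v. (C_r, v) \<in> C5 \<and> F v) \<longleftrightarrow> F C_r \<or> F C_a \<or> F C_b \<or> F C_c \<or> F C_t \<or> F C_d"
  "(\<exists>v. (C_a, v) \<in> C5 \<and> F v) \<longleftrightarrow> F C_a \<or> F C_c \<or> F C_t"
  "(\<exists>v. (C_b, v) \<in> C5 \<and> F v) \<longleftrightarrow> F C_b \<or> F C_t \<or> F C_d"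
  "(\<exists>v. (C_c, v) \<in> C5 \<and> F v) \<longleftrightarrow> F C_c"
  "(\<exists>v. (C_t, v) \<in> C5 \<and> F v) \<longleftrightarrow> F C_t"
  "(\<exists>v. (C_d, v) \<in> C5 \<and> F v) \<longleftrightarrow> F C_d"
  unfolding ex_above Image_C5 by simp_all

definition Neg :: "fm \<Rightarrow> fm" where
  "Neg A = Imp A Falsum"

text \<open>With \<open>p, q, y, u\<close> for the variables 0, 1, 2, 3, the formula requires \<open>y\<close> below any three
  points of the types \<open>p \<and> \<not> q\<close>, \<open>q \<and> \<not> p\<close>, \<open>\<not> p \<and> \<not> q\<close>. The unifier below makes \<open>y\<close> fail only
  below a non-maximal point forcing \<open>p\<close>, which in both frames excludes one of the types.\<close>

definition bad_formula :: fm where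
  "bad_formula = Or (Var 2) (Or (Neg (And (Var 0) (Neg (Var 1))))
     (Or (Neg (And (Var 1) (Neg (Var 0)))) (Neg (And (Neg (Var 0)) (Neg (Var 1))))))"

definition bad_unifier :: substitution where
  "bad_unifier x = (if x = 0 then Var 0 else if x = 1 then Var 1
     else if x = 2 then Or (Var 0) (Imp (Var 0) (Or (Var 3) (Neg (Var 3)))) else Falsum)"

text \<open>Once the quantifiers over points are expanded, each \<open>w\<close> leaves a
  propositional claim about the values of the variables 0, 1 and 3, with persistence given along the
  covering pairs.\<close>

lemma bad_unifier_G2: "unifier (logic_of G2) bad_formula bad_unifier"
  unfolding unifier_def logic_of_def
proof (intro CollectI allI impI ballI)
  fix V w assume V: "persistent G2 V"
  have "V G_r x \<longrightarrow> V G_a x \<and> V G_b x" "V G_b x \<longrightarrow> V G_c x \<and> V G_d x" for x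
    using V by (auto simp: persistent_def G2_eq)
  from this[of 0] this[of 1] this[of 3] show "forces G2 V w (subst bad_unifier bad_formula)"
    by (cases w) (simp_all add: bad_formula_def bad_unifier_def Neg_def all_G2 ex_G2, argo)
qed

lemma bad_unifier_C5: "unifier (logic_of C5) bad_formula bad_unifier"
  unfolding unifier_def logic_of_def
proof (intro CollectI allI impI ballI)
  fix V w assume V: "persistent C5 V"
  have "V C_r x \<longrightarrow> V C_a x \<and> V C_b x" "V C_a x \<longrightarrow> V C_c x \<and> V C_t x"
    "V C_b x \<longrightarrow> V C_t x \<and> V C_d x" for x
    using V by (auto simp: persistent_def C5_eq)
  from this[of 0] this[of 1] this[of 3] show "forces C5 V w (subst bad_unifier bad_formula)"
    by (cases w) (simp_all add: bad_formula_def bad_unifier_def Neg_def all_C5 ex_C5, argo)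
qed

text \<open>As modus ponens is the only rule, soundness is local: a premise forced at a single point
  yields its consequences at that point.\<close>

lemma (in kripke) derives_sound:
  assumes "derives L {B} C" "L \<subseteq> logic_of R" "persistent R V" "w \<in> Field R" "forces R V w B"
  shows "forces R V w C"
  using assms(1)
proof induction
  case (mp A C)
  then show ?case using refl_R[OF assms(4)] by auto
qed (use assms in \<open>auto simp: logic_of_def\<close>)

text \<open>Values of \<open>bad_unifier\<close> yield a point \<open>s\<close> with \<open>y\<close> false below points of the first two types,
  and a point of the third type. If it unifies \<open>B\<close>, a projective unifier of \<open>B\<close> moves the root of
  the model putting \<open>s\<close> at \<open>G_b\<close> and the third type at \<open>G_a\<close> into \<open>B\<close>, without changing the other points.\<close>

lemma no_projective_approximation:
  assumes L: "L \<subseteq> logic_of G2" and u: "unifier L bad_formula bad_unifier"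
  shows "\<not> projective_approximation L"
proof
  assume "projective_approximation L"
  then obtain B \<epsilon> where Bu: "unifier L B bad_unifier" and pr: "projective_unifier L B \<epsilon>"
    and BA: "derives L {B} bad_formula"
    using u unfolding projective_approximation_def by metis
  have B: "forces G2 (\<lambda>w x. forces G2 V w (bad_unifier x)) w B" if "persistent G2 V" for V w
    using Bu L that by (auto simp: unifier_def logic_of_def G2.forces_subst Field_G2)
  \<comment> \<open>Under \<open>V1\<close> the value of \<open>y\<close> fails at
    \<open>G_r\<close> alone, because \<open>G_b\<close> above it forces \<open>p\<close> but not
    \<open>u\<close> or its negation. This yields \<open>W1\<close>; the all-false valuation yields
    \<open>W2\<close>, the third type with \<open>y\<close> true.\<close>
  define V1 :: "g2_world \<Rightarrow> nat \<Rightarrow> bool" where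
    "V1 w x \<longleftrightarrow> x = 0 \<and> w \<in> {G_b, G_c, G_d} \<or> x = 1 \<and> w = G_a \<or> x = 3 \<and> w = G_c" for w x
  define W1 :: "g2_world \<Rightarrow> nat \<Rightarrow> bool" where
    "W1 w x \<longleftrightarrow> x = 0 \<and> w \<in> {G_b, G_c, G_d} \<or> x = 1 \<and> w = G_a \<or> x = 2 \<and> w \<noteq> G_r" for w x
  define W2 :: "g2_world \<Rightarrow> nat \<Rightarrow> bool" where "W2 w x \<longleftrightarrow> x = 2" for w x
  define W :: "g2_world \<Rightarrow> nat \<Rightarrow> bool" where
    "W w x \<longleftrightarrow> x = 0 \<and> w = G_c \<or> x = 1 \<and> w = G_d \<or> x = 2 \<and> w \<in> {G_a, G_c, G_d}" for w x
  have V1: "persistent G2 V1" and W: "persistent G2 W"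
    by (auto simp: persistent_def V1_def W_def G2_eq)
  have "(\<lambda>w x. forces G2 V1 w (bad_unifier x)) = W1"
    by (intro ext, rename_tac w x, case_tac w) (auto simp: bad_unifier_def Neg_def V1_def W1_def all_G2 ex_G2)
  then have B1: "forces G2 W1 w B" for w using B[OF V1] by simp
  have "(\<lambda>w x. forces G2 (\<lambda>_ _. False) w (bad_unifier x)) = W2"
    by (intro ext) (auto simp: bad_unifier_def Neg_def W2_def)
  then have B2: "forces G2 W2 w B" for w
    using B[of "\<lambda>_ _. False"] by (simp add: persistent_def)
  \<comment> \<open>\<open>G_b\<close>, \<open>G_c\<close> and \<open>G_d\<close> of
    \<open>W1\<close> behave as one point, so \<open>G_r\<close> of \<open>W1\<close> looks like
    \<open>G_b\<close> of \<open>W\<close>. The last two clauses carry this collapse through the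
    implication case.\<close>
  have bisim: "forces G2 W G_a C = forces G2 W2 G_a C \<and> forces G2 W G_b C = forces G2 W1 G_r C \<and>
      forces G2 W G_c C = forces G2 W1 G_c C \<and> forces G2 W G_d C = forces G2 W1 G_a C \<and>
      forces G2 W1 G_b C = forces G2 W1 G_c C \<and> forces G2 W1 G_d C = forces G2 W1 G_c C" for C
  proof (induction C)
    case (Var x)
    show ?case by (auto simp: W_def W1_def W2_def)
  next
    case (Imp C1 C2)
    then show ?case by (auto simp: all_G2)
  qed auto
  have BW: "forces G2 W w B" if "w \<noteq> G_r" for w
    using that bisim[of B] B1 B2 by (cases w) auto
  let ?W = "\<lambda>w x. forces G2 W w (\<epsilon> x)"
  have P: "persistent G2 ?W" by (rule G2.persistent_subst[OF W])
  have "forces G2 ?W G_r B"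
    using pr L W by (auto simp: projective_unifier_def unifier_def logic_of_def G2.forces_subst Field_G2)
  then have A: "forces G2 ?W G_r bad_formula"
    using G2.derives_sound[OF BA L P] by (simp add: Field_G2)
  \<comment> \<open>Off the root \<open>B\<close> is forced in \<open>W\<close>, so projectivity
    leaves every variable unchanged there.\<close>
  have eq: "?W w x = W w x" if "w \<noteq> G_r" for w x
  proof -
    have "derives L {B} (Iff (\<epsilon> x) (Var x))" using pr by (simp add: projective_unifier_def)
    then have "forces G2 W w (Iff (\<epsilon> x) (Var x))"
      using G2.derives_sound[OF _ L W _ BW[OF that]] by (simp add: Field_G2)
    then show ?thesis using G2.refl_R by (auto simp: Iff_def Field_G2)
  qed
  \<comment> \<open>\<open>y\<close> fails at \<open>G_b\<close>, hence at the root, while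
    \<open>G_c\<close>, \<open>G_d\<close> and \<open>G_a\<close> realise the three types; so
    \<open>bad_formula\<close> fails at the root.\<close>
  have y: "\<not> ?W G_r 2"
    using P eq[of G_b 2] by (auto simp: persistent_def W_def G2_eq)
  show False
    using A y eq[of G_a] eq[of G_c] eq[of G_d]
    by (auto simp: bad_formula_def Neg_def all_G2 ex_G2 W_def)
qed

theorem theorem4p15:
  "finitary_unification (logic_of G2) \<and>
   finitary_unification (logic_of G2 \<inter> logic_of C5) \<and>
   \<not> projective_approximation (logic_of G2) \<and>
   \<not> projective_approximation (logic_of G2 \<inter> logic_of C5)"
proof -
  have "unifier (logic_of G2 \<inter> logic_of C5) bad_formula bad_unifier"
    using bad_unifier_G2 bad_unifier_C5 by (simp add: unifier_def)
  then show ?thesis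
    using finitary_G2 finitary_G2_C5 bad_unifier_G2 no_projective_approximation by blast
qed

end
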